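(* Let $(S,d_S)$ be a complete separable metric space (with its Borel $\sigma$-algebra) of finite diameter, let $d\ge 1$ and $\Omega=S^{\mathbb{Z}^d}$, and assume that the set of bounded quasi-local functions on $\Omega$ is measure separating. Let $\lambda$ be a probability measure on $S$ (the a priori measure) and let $U$ be a uniformly absolutely summable translation-invariant potential. If $\mu\in\mathcal{G}_\tau(U)$ satisfies $\mathrm{GCB}(C)$ for some $C>0$, then $$\mathcal{G}_\tau(U)=\{\mu\}.$$
   Context: $\Omega=S^{\mathbb{Z}^d}$ carries the product topology and the product $\sigma$-algebra $\mathfrak{B}$; all probability measures on $\Omega$ are defined on $\mathfrak{B}$. For $i\in\mathbb{Z}^d$ and $\sigma\in\Omega$ put $(\tau_i\sigma)_j=\sigma_{j-i}$ for all $j\in\mathbb{Z}^d$. A probability measure $\mu$ on $\Omega$ is translation invariant if $\mu(\tau_iB)=\mu(B)$ for all $B\in\mathfrak{B}$, $i\in\mathbb{Z}^d$. For $\Lambda\subset\mathbb{Z}^d$, $\mathfrak{B}_\Lambda$ is the $\sigma$-algebra generated by the coordinates $\eta_i$, $i\in\Lambda$, and $\eta_\Lambda\xi_{\Lambda^c}$ denotes the configuration equal to $\eta$ on $\Lambda$ and to $\xi$ on $\Lambda^c$. Let $\mathcal{S}$ be the set of finite subsets of $\mathbb{Z}^d$. For continuous $f:\Omega\to\mathbb{R}$ and $i\in\mathbb{Z}^d$, the local oscillation is $\delta_if=\sup\{f(\sigma)-f(\eta):\sigma,\eta\in\Omega,\ \sigma_j=\eta_j\ \forall j\neq i\}\in[0,\infty]$,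 and $\|\delta f\|_2^2=\sum_{i\in\mathbb{Z}^d}(\delta_if)^2$. A continuous function $f$ is local if $\delta_if\neq0$ for only finitely many $i$; a continuous function is quasi-local if it is a uniform limit of local functions. Measure separating means: for any two distinct probability measures $\mu,\mu'$ on $\Omega$ there is a bounded quasi-local $f$ with $\int f\,d\mu\neq\int f\,d\mu'$. $\mu$ satisfies $\mathrm{GCB}(C)$ if for all bounded local functions $f$, $\int e^{f-\int f\,d\mu}\,d\mu\le e^{\frac{C}{2}\|\delta f\|_2^2}$. A uniformly absolutely summable translation-invariant potential is a function $U:\mathcal{S}\times\Omega\to\mathbb{R}$ such that (a) for all $A\in\mathcal{S}$, $U(A,\cdot)$ is $\mathfrak{B}_A$-measurable and continuous; (b) $\sum_{A\ni0}\|U(A,\cdot)\|_\infty<\infty$; (c) $U(A+i,\tau_i\sigma)=U(A,\sigma)$ for all $\sigma\in\Omega$, $A\in\mathcal{S}$, $i\in\mathbb{Z}^d$. For $\Lambda\in\mathcal{S}$ let $\lambda_\Lambda(d\sigma_\Lambda)=\bigotimes_{i\in\Lambda}\lambda(d\sigma_i)$ on $S^\Lambda$. For a boundary condition $\xi\in\Omega$ set $H^\xi_\Lambda(\sigma_\Lambda)=\sum_{A\in\mathcal{S},\,A\cap\Lambda\neq\emptyset}U(A,\sigma_\Lambda\xi_{\Lambda^c})$, $Z^\xi_\Lambda=\int e^{-H^\xi_\Lambda(\sigma_\Lambda)}\lambda_\Lambda(d\sigma_\Lambda)$, and $\gamma_\Lambda(d\sigma_\Lambda|\xi)=\frac{e^{-H^\xi_\Lambda(\sigma_\Lambda)}}{Z^\xi_\Lambda}\lambda_\Lambda(d\sigma_\Lambda)$.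 A probability measure $\mu$ on $\Omega$ is Gibbs with potential $U$ (and a priori measure $\lambda$) if for all bounded measurable $f:\Omega\to\mathbb{R}$ and all $\Lambda\in\mathcal{S}$, $\mathbb{E}_\mu(f|\mathfrak{B}_{\Lambda^c})(\xi)=\int f(\sigma_\Lambda\xi_{\Lambda^c})\,\gamma_\Lambda(d\sigma_\Lambda|\xi)$ for $\mu$-almost every $\xi$. $\mathcal{G}_\tau(U)$ denotes the set of translation-invariant Gibbs measures with potential $U$ (and a priori measure $\lambda$). *)

theory Defs
  imports "HOL-Probability.Probability"
begin

text \<open>
  The spin space is the type \<open>'a\<close>, the lattice \<open>Z^d\<close> is the type \<open>int ^ 'd\<close>, so \<open>d = CARD('d) \<ge> 1\<close>.
  Configurations are total functions on the lattice, and the topology on them is the library's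
  product topology on function types.
\<close>

type_synonym 'd site = "int ^ 'd"
type_synonym ('a, 'd) config = "int ^ 'd \<Rightarrow> 'a"

definition config_space :: "('a::topological_space, 'd::finite) config measure" where
  "config_space = PiM UNIV (\<lambda>_. borel)"

definition is_prob_on_configs :: "('a::topological_space, 'd::finite) config measure \<Rightarrow> bool" where
  "is_prob_on_configs M \<longleftrightarrow> prob_space M \<and> sets M = sets config_space"

definition shift :: "'d::finite site \<Rightarrow> ('a, 'd) config \<Rightarrow> ('a, 'd) config" where
  "shift i \<sigma> = (\<lambda>j. \<sigma> (j - i))"

definition translation_invariant :: "('a, 'd::finite) config measure \<Rightarrow> bool" where
  "translation_invariant M \<longleftrightarrow>
     (\<forall>i. \<forall>B\<in>sets M. emeasure M (shift i ` B) = emeasure M B)"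

text \<open>Only the space and the sets of the following measure matter.\<close>

definition coord_algebra :: "'d::finite site set \<Rightarrow> ('a::topological_space, 'd) config measure" where
  "coord_algebra \<Lambda> = sigma UNIV {(\<lambda>\<eta>. \<eta> i) -` B | i B. i \<in> \<Lambda> \<and> B \<in> sets borel}"

text \<open>
  The local oscillation takes values in \<open>[0,\<infinity>]\<close>. The truncation of negative differences by
  \<open>ennreal\<close> does not change the supremum, since the pairs with \<open>\<sigma> = \<eta>\<close> contribute \<open>0\<close>.
\<close>

definition oscillation :: "'d::finite site \<Rightarrow> (('a, 'd) config \<Rightarrow> real) \<Rightarrow> ennreal" where
  "oscillation i f = (SUP (\<sigma>, \<eta>) \<in> {(\<sigma>, \<eta>). \<forall>j. j \<noteq> i \<longrightarrow> \<sigma> j = \<eta> j}. ennreal (f \<sigma> - f \<eta>))"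

definition osc_norm_sq :: "(('a, 'd::finite) config \<Rightarrow> real) \<Rightarrow> ennreal" where
  "osc_norm_sq f = (\<Sum>\<^sub>\<infinity>i. (oscillation i f)\<^sup>2)"

definition local_fun :: "(('a::topological_space, 'd::finite) config \<Rightarrow> real) \<Rightarrow> bool" where
  "local_fun f \<longleftrightarrow> continuous_on UNIV f \<and> finite {i. oscillation i f \<noteq> 0}"

definition quasilocal_fun :: "(('a::topological_space, 'd::finite) config \<Rightarrow> real) \<Rightarrow> bool" where
  "quasilocal_fun f \<longleftrightarrow> continuous_on UNIV f \<and>
     (\<exists>F :: nat \<Rightarrow> ('a, 'd) config \<Rightarrow> real.
        (\<forall>n. local_fun (F n)) \<and> uniform_limit UNIV F f sequentially)"

definition measure_separating :: "(('a::topological_space, 'd::finite) config \<Rightarrow> real) set \<Rightarrow> bool" where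
  "measure_separating \<F> \<longleftrightarrow>
     (\<forall>M N. is_prob_on_configs M \<longrightarrow> is_prob_on_configs N \<longrightarrow> M \<noteq> N \<longrightarrow>
        (\<exists>f\<in>\<F>. (\<integral>\<sigma>. f \<sigma> \<partial>M) \<noteq> (\<integral>\<sigma>. f \<sigma> \<partial>N)))"

text \<open>For bounded local functions \<open>osc_norm_sq f\<close> is finite, so \<open>enn2real\<close> loses nothing.\<close>

definition GCB :: "('a::topological_space, 'd::finite) config measure \<Rightarrow> real \<Rightarrow> bool" where
  "GCB M C \<longleftrightarrow>
     (\<forall>f. local_fun f \<longrightarrow> bounded (range f) \<longrightarrow>
        (\<integral>\<sigma>. exp (f \<sigma> - (\<integral>\<eta>. f \<eta> \<partial>M)) \<partial>M) \<le> exp (C / 2 * enn2real (osc_norm_sq f)))"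

text \<open>
  A potential is a function on the finite subsets of the lattice; its values at infinite sets are
  irrelevant, and every condition below is restricted to finite sets.
\<close>

type_synonym ('a, 'd) potential = "(int ^ 'd) set \<Rightarrow> ('a, 'd) config \<Rightarrow> real"

definition uas_ti_potential :: "('a::topological_space, 'd::finite) potential \<Rightarrow> bool" where
  "uas_ti_potential U \<longleftrightarrow>
     (\<forall>A. finite A \<longrightarrow> U A \<in> borel_measurable (coord_algebra A) \<and> continuous_on UNIV (U A)) \<and>
     (\<Sum>\<^sub>\<infinity>A\<in>{A. finite A \<and> 0 \<in> A}. SUP \<sigma>. ennreal \<bar>U A \<sigma>\<bar>) < \<infinity> \<and>
     (\<forall>A i \<sigma>. finite A \<longrightarrow> U ((\<lambda>j. j + i) ` A) (shift i \<sigma>) = U A \<sigma>)"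

text \<open>
  In the following, \<open>override_on \<xi> \<sigma> \<Lambda>\<close> is the configuration equal to \<open>\<sigma>\<close> on \<open>\<Lambda>\<close> and to \<open>\<xi>\<close> off \<open>\<Lambda>\<close>.
\<close>

definition hamiltonian ::
  "('a, 'd::finite) potential \<Rightarrow> 'd site set \<Rightarrow> ('a, 'd) config \<Rightarrow> ('a, 'd) config \<Rightarrow> real" where
  "hamiltonian U \<Lambda> \<xi> \<sigma> = (\<Sum>\<^sub>\<infinity>A\<in>{A. finite A \<and> A \<inter> \<Lambda> \<noteq> {}}. U A (override_on \<xi> \<sigma> \<Lambda>))"

definition partition_function ::
  "'a measure \<Rightarrow> ('a, 'd::finite) potential \<Rightarrow> 'd site set \<Rightarrow> ('a, 'd) config \<Rightarrow> real" where
  "partition_function lam U \<Lambda> \<xi> = (\<integral>\<sigma>. exp (- hamiltonian U \<Lambda> \<xi> \<sigma>) \<partial>PiM \<Lambda> (\<lambda>_. lam))"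

definition gibbs_kernel ::
  "'a measure \<Rightarrow> ('a, 'd::finite) potential \<Rightarrow> 'd site set \<Rightarrow> ('a, 'd) config \<Rightarrow> ('a, 'd) config measure" where
  "gibbs_kernel lam U \<Lambda> \<xi> =
     density (PiM \<Lambda> (\<lambda>_. lam))
       (\<lambda>\<sigma>. ennreal (exp (- hamiltonian U \<Lambda> \<xi> \<sigma>) / partition_function lam U \<Lambda> \<xi>))"

definition is_gibbs ::
  "'a::topological_space measure \<Rightarrow> ('a, 'd::finite) potential \<Rightarrow> ('a, 'd) config measure \<Rightarrow> bool" where
  "is_gibbs lam U M \<longleftrightarrow> is_prob_on_configs M \<and>
     (\<forall>f \<Lambda>. f \<in> borel_measurable config_space \<longrightarrow> bounded (range f) \<longrightarrow> finite \<Lambda> \<longrightarrow>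
        (AE \<xi> in M. real_cond_exp M (coord_algebra (- \<Lambda>)) f \<xi> =
           (\<integral>\<sigma>. f (override_on \<xi> \<sigma> \<Lambda>) \<partial>gibbs_kernel lam U \<Lambda> \<xi>)))"

definition ti_gibbs_measures ::
  "'a::topological_space measure \<Rightarrow> ('a, 'd::finite) potential \<Rightarrow> ('a, 'd) config measure set" where
  "ti_gibbs_measures lam U = {M. is_gibbs lam U M \<and> translation_invariant M}"

end

theory Submission
  imports Defs "HOL-Real_Asymp.Real_Asymp"
begin

text \<open>
  If \<open>\<mu>\<close> and \<open>\<nu>\<close> are Gibbs for the same potential, then on events of a finite volume \<open>W\<close> their
  densities differ at most by a factor \<open>exp (4 b(W))\<close>, where \<open>b(W)\<close> sums the norms of the interactions
  that cross the boundary of \<open>W\<close>; for boxes, \<open>b(W)\<close> is negligible against the volume. For a local \<open>f\<close>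
  let \<open>F\<close> be \<open>t > 0\<close> times the sum of the translates of \<open>f\<close> over a box of \<open>N\<close> sites. Jensen's inequality
  for \<open>\<nu>\<close>, the comparison of densities, and concentration for \<open>\<mu>\<close> give
  \<open>t N (\<nu>(f) - \<mu>(f)) \<le> o(N) + c t\<^sup>2 N\<close>, because the squared oscillation norm of \<open>F\<close> is of order
  \<open>t\<^sup>2 N\<close>. Hence \<open>\<nu>(f) - \<mu>(f) \<le> c t\<close> for every \<open>t > 0\<close>, so \<open>\<nu>(f) \<le> \<mu>(f)\<close>; the same holds for \<open>- f\<close>.
\<close>

section \<open>Functions depending on finitely many coordinates\<close>

text \<open>Pointwise dependence is the form of locality that passes directly through
  \<open>override_on\<close> and shifts. Local functions and real functions measurable for
  \<open>coord_algebra\<close> are shown below to have it.\<close>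

definition depends_on :: "'i set \<Rightarrow> (('i \<Rightarrow> 'a) \<Rightarrow> 'b) \<Rightarrow> bool" where
  "depends_on J f \<longleftrightarrow> (\<forall>\<sigma> \<eta>. (\<forall>j\<in>J. \<sigma> j = \<eta> j) \<longrightarrow> f \<sigma> = f \<eta>)"

lemma depends_onD: "depends_on J f \<Longrightarrow> (\<And>j. j \<in> J \<Longrightarrow> \<sigma> j = \<eta> j) \<Longrightarrow> f \<sigma> = f \<eta>"
  unfolding depends_on_def by blast

lemma depends_on_mono: "depends_on J f \<Longrightarrow> J \<subseteq> K \<Longrightarrow> depends_on K f"
  unfolding depends_on_def by blast

lemma oscillation_ge:
  assumes "\<And>j. j \<noteq> i \<Longrightarrow> \<sigma> j = \<eta> j"
  shows "ennreal (f \<sigma> - f \<eta>) \<le> oscillation i f"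
  unfolding oscillation_def by (rule SUP_upper2[of "(\<sigma>, \<eta>)"]) (use assms in auto)

lemma oscillation_le:
  assumes "\<And>\<sigma> \<eta>. (\<And>j. j \<noteq> i \<Longrightarrow> \<sigma> j = \<eta> j) \<Longrightarrow> f \<sigma> - f \<eta> \<le> c"
  shows "oscillation i f \<le> ennreal c"
  unfolding oscillation_def by (rule SUP_least) (auto intro!: ennreal_leI assms)

lemma oscillation_eq_0_iff:
  fixes f :: "('a, 'd::finite) config \<Rightarrow> real"
  shows
  "oscillation i f = 0 \<longleftrightarrow> (\<forall>\<sigma> \<eta>. (\<forall>j. j \<noteq> i \<longrightarrow> \<sigma> j = \<eta> j) \<longrightarrow> f \<sigma> = f \<eta>)"
proof
  assume 0: "oscillation i f = 0"
  \<comment> \<open>The truncation by \<open>ennreal\<close> leaves only this one-sided bound;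
    exchanging \<sigma> and \<eta> supplies the other.\<close>
  have le: "f \<sigma> \<le> f \<eta>" if "\<forall>j. j \<noteq> i \<longrightarrow> \<sigma> j = \<eta> j" for \<sigma> \<eta>
    using oscillation_ge[of i \<sigma> \<eta> f] that 0 by (simp add: ennreal_eq_0_iff)
  show "\<forall>\<sigma> \<eta>. (\<forall>j. j \<noteq> i \<longrightarrow> \<sigma> j = \<eta> j) \<longrightarrow> f \<sigma> = f \<eta>"
    by (intro allI impI antisym le) auto
next
  assume eq: "\<forall>\<sigma> \<eta>. (\<forall>j. j \<noteq> i \<longrightarrow> \<sigma> j = \<eta> j) \<longrightarrow> f \<sigma> = f \<eta>"
  have "oscillation i f \<le> ennreal 0"
  proof (rule oscillation_le)
    fix \<sigma> \<eta> :: "('a, 'd) config" assume "\<And>j. j \<noteq> i \<Longrightarrow> \<sigma> j = \<eta> j"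
    with eq have "f \<sigma> = f \<eta>" by blast
    then show "f \<sigma> - f \<eta> \<le> 0" by simp
  qed
  then show "oscillation i f = 0" by simp
qed

lemma depends_on_oscillation_eq_0:
  fixes f :: "('a, 'd::finite) config \<Rightarrow> real"
  assumes "depends_on J f" "i \<notin> J"
  shows "oscillation i f = 0"
  unfolding oscillation_eq_0_iff
proof (intro allI impI)
  fix \<sigma> \<eta> :: "('a, 'd) config" assume "\<forall>j. j \<noteq> i \<longrightarrow> \<sigma> j = \<eta> j"
  with \<open>i \<notin> J\<close> show "f \<sigma> = f \<eta>"
    by (intro depends_onD[OF assms(1)]) auto
qed

text \<open>Coordinate \<open>i\<close> is constant as soon as \<open>K\<close> contains
  \<open>i\<close>, and coordinatewise convergence is convergence in the product topology.\<close>

lemma tendsto_override_on: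
  fixes \<sigma> \<eta> :: "'i \<Rightarrow> 'a::topological_space"
  shows "((\<lambda>K. override_on \<sigma> \<eta> K) \<longlongrightarrow> \<eta>) (finite_subsets_at_top UNIV)"
proof -
  have "((\<lambda>K. override_on \<sigma> \<eta> K i) \<longlongrightarrow> \<eta> i) (finite_subsets_at_top UNIV)" for i
    by (rule tendsto_eventually)
       (auto simp: eventually_finite_subsets_at_top override_on_def intro!: exI[of _ "{i}"])
  then show ?thesis
    unfolding limitin_canonical_iff[symmetric] euclidean_product_topology[symmetric]
    by (simp add: limitin_componentwise del: limitin_canonical_iff)
qed

text \<open>
  Finitely many coordinates with zero oscillation can be changed one at a time; by continuity all of
  them can be changed simultaneously.
\<close>

lemma local_fun_depends_on:
  fixes f :: "('a::topological_space, 'd::finite) config \<Rightarrow> real"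
  assumes "local_fun f"
  shows "depends_on {i. oscillation i f \<noteq> 0} f"
  unfolding depends_on_def
proof (intro allI impI)
  fix \<sigma> \<eta> :: "('a, 'd) config"
  assume eq: "\<forall>j\<in>{i. oscillation i f \<noteq> 0}. \<sigma> j = \<eta> j"
  have const: "f (override_on \<sigma> \<eta> K) = f \<sigma>" if "finite K" for K
    using that
  proof induction
    case (insert i K)
    have "f (override_on \<sigma> \<eta> (insert i K)) = f (override_on \<sigma> \<eta> K)"
    \<comment> \<open>Either changing site \<open>i\<close> cannot be seen by \<open>f\<close>, or
      \<sigma> and \<eta> already agree there and nothing changes.\<close>
    proof (cases "oscillation i f = 0")
      case True
      then show ?thesis
        unfolding oscillation_eq_0_iff by (auto simp: override_on_def)
    next
      case False
      then have "override_on \<sigma> \<eta> (insert i K) = override_on \<sigma> \<eta> K"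
        using eq by (auto simp: override_on_def)
      then show ?thesis by simp
    qed
    with insert show ?case by simp
  qed simp
  have "continuous_on UNIV f"
    using assms by (simp add: local_fun_def)
  then have "((\<lambda>K. f (override_on \<sigma> \<eta> K)) \<longlongrightarrow> f \<eta>) (finite_subsets_at_top UNIV)"
    by (rule continuous_on_tendsto_compose) (auto intro: tendsto_override_on)
  moreover have "((\<lambda>K. f (override_on \<sigma> \<eta> K)) \<longlongrightarrow> f \<sigma>) (finite_subsets_at_top UNIV)"
    by (rule tendsto_eventually)
       (auto intro!: eventually_finite_subsets_at_top_weakI const)
  ultimately show "f \<sigma> = f \<eta>"
    using tendsto_unique finite_subsets_at_top_neq_bot by blast
qed

lemma depends_on_local_fun:
  assumes "continuous_on UNIV f" "depends_on J f" "finite J"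
  shows "local_fun f"
  unfolding local_fun_def
  using assms depends_on_oscillation_eq_0[OF assms(2)]
  by (auto intro: finite_subset[of _ J])

text \<open>Sites outside \<open>J\<close> have zero oscillation, so the series collapses to a
  finite sum with at most \<open>c\<^sup>2\<close> per site.\<close>

lemma osc_norm_sq_le:
  assumes "depends_on J f" "finite J" "c \<ge> 0"
    and "\<And>i \<sigma> \<eta>. (\<And>j. j \<noteq> i \<Longrightarrow> \<sigma> j = \<eta> j) \<Longrightarrow> f \<sigma> - f \<eta> \<le> c"
  shows "enn2real (osc_norm_sq f) \<le> real (card J) * c\<^sup>2"
proof -
  have "osc_norm_sq f = (\<Sum>i\<in>J. (oscillation i f)\<^sup>2)"
    unfolding osc_norm_sq_def
    using depends_on_oscillation_eq_0[OF assms(1)] \<open>finite J\<close>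
    by (subst infsum_cong_neutral[where T = J and g = "\<lambda>i. (oscillation i f)\<^sup>2"]) auto
  also have "\<dots> \<le> (\<Sum>i\<in>J. (ennreal c)\<^sup>2)"
    by (intro sum_mono power_mono oscillation_le assms) auto
  also have "\<dots> = ennreal (real (card J) * c\<^sup>2)"
    using \<open>c \<ge> 0\<close> by (simp add: ennreal_power ennreal_mult ennreal_of_nat_eq_real_of_nat)
  finally show ?thesis
    using \<open>c \<ge> 0\<close> by (simp add: enn2real_leI)
qed

section \<open>Measures on configurations\<close>

text \<open>The lattice is countable and the spin space second countable, so the product and the
  Borel sigma-algebra agree. This makes continuous functions measurable.\<close>

lemma sets_config_space:
  "sets (config_space :: ('a::second_countable_topology, 'd::finite) config measure) = sets borel"
  unfolding config_space_def by (rule sets_PiM_equal_borel)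

lemma borel_measurable_continuous_config:
  fixes f :: "('a::second_countable_topology, 'd::finite) config \<Rightarrow> real"
  assumes "continuous_on UNIV f"
  shows "f \<in> borel_measurable config_space"
  using borel_measurable_continuous_onI[OF assms] measurable_cong_sets[OF sets_config_space refl] by blast

text \<open>The events that cannot distinguish two configurations agreeing on \<open>A\<close> form
  a sigma-algebra containing the generators. Applied to the level sets of \<open>f\<close>, this
  gives the claim.\<close>

lemma depends_on_coord_algebra_measurable:
  fixes f :: "('a::topological_space, 'd::finite) config \<Rightarrow> real"
  assumes "f \<in> borel_measurable (coord_algebra A)"
  shows "depends_on A f"
proof -
  have inv: "\<sigma> \<in> B \<longleftrightarrow> \<eta> \<in> B"
    if "B \<in> sets (coord_algebra A)" and eq: "\<And>j. j \<in> A \<Longrightarrow> \<sigma> j = \<eta> j"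
    for B and \<sigma> \<eta> :: "('a, 'd) config"
  proof -
    from that(1) have "B \<in> sigma_sets UNIV {(\<lambda>\<eta>. \<eta> i) -` B | i B. i \<in> A \<and> B \<in> sets borel}"
      unfolding coord_algebra_def by simp
    then show ?thesis
      by induction (use eq in auto)
  qed
  have "f -` {f \<eta>} \<inter> space (coord_algebra A) \<in> sets (coord_algebra A)" for \<eta>
    by (rule measurable_sets[OF assms]) auto
  moreover have "space (coord_algebra A) = (UNIV :: ('a, 'd) config set)"
    by (simp add: coord_algebra_def)
  ultimately have "f -` {f \<eta>} \<in> sets (coord_algebra A)" for \<eta>
    by simp
  from inv[OF this] show ?thesis
    unfolding depends_on_def by (metis vimage_singleton_eq)
qed

lemma is_prob_on_configsD:
  fixes M :: "('a::topological_space, 'd::finite) config measure"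
  assumes "is_prob_on_configs M"
  shows "prob_space M" "space M = UNIV" "sets M = sets config_space"
    "\<And>f :: ('a, 'd) config \<Rightarrow> real. f \<in> borel_measurable config_space \<Longrightarrow> f \<in> borel_measurable M"
proof -
  show s: "prob_space M" "sets M = sets config_space"
    using assms by (simp_all add: is_prob_on_configs_def)
  show "space M = UNIV"
    using sets_eq_imp_space_eq[OF s(2)] by (simp add: config_space_def space_PiM)
  show "\<And>f :: ('a, 'd) config \<Rightarrow> real. f \<in> borel_measurable config_space \<Longrightarrow> f \<in> borel_measurable M"
    using measurable_cong_sets[OF s(2) refl] by blast
qed

lemma subalgebra_coord_algebra:
  fixes M :: "('a::topological_space, 'd::finite) config measure"
  assumes "is_prob_on_configs M"
  shows "subalgebra M (coord_algebra \<Lambda>)"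
proof -
  note s = is_prob_on_configsD(3)[OF assms] and sp = is_prob_on_configsD(2)[OF assms]
  have "(\<lambda>\<eta>. \<eta> i) -` B \<in> sets M" if "B \<in> sets borel" for i B
  proof -
    have "(\<lambda>\<eta>. \<eta> i) \<in> measurable (config_space :: ('a, 'd) config measure) borel"
      unfolding config_space_def by measurable
    from measurable_sets[OF this that] show ?thesis
      unfolding s by (simp add: config_space_def space_PiM)
  qed
  then have "{(\<lambda>\<eta>. \<eta> i) -` B | i B. i \<in> \<Lambda> \<and> B \<in> sets borel} \<subseteq> sets M"
    by auto
  then have "sigma_sets (space M) {(\<lambda>\<eta>. \<eta> i) -` B | i B. i \<in> \<Lambda> \<and> B \<in> sets borel} \<subseteq> sets M"
    by (rule sets.sigma_sets_subset)
  then show ?thesis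
    unfolding subalgebra_def by (simp add: sp coord_algebra_def)
qed

section \<open>Shifts and invariance of integrals\<close>

lemma shift_shift [simp]: "shift i (shift j \<sigma>) = shift (i + j) \<sigma>"
  by (simp add: shift_def algebra_simps)

lemma shift_0 [simp]: "shift 0 \<sigma> = \<sigma>"
  by (simp add: shift_def)

lemma surj_shift: "range (shift i) = UNIV"
  by (metis add.right_inverse shift_0 shift_shift surjI)

text \<open>Translation invariance is stated for images under shifts, whereas push-forward measures
  are computed from preimages; this identity links the two.\<close>

lemma vimage_shift: "shift (- i) -` B = shift i ` B"
proof
  show "shift (- i) -` B \<subseteq> shift i ` B"
    by (auto intro!: image_eqI[of _ _ "shift (- i) _"])
qed auto

lemma continuous_on_shift: "continuous_on UNIV (shift i :: ('a::topological_space, 'd::finite) config \<Rightarrow> _)"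
  unfolding shift_def by (intro continuous_on_coordinatewise_then_product continuous_on_product_coordinates)

lemma integral_shift:
  fixes M :: "('a::second_countable_topology, 'd::finite) config measure"
    and f :: "('a, 'd) config \<Rightarrow> real"
  assumes "is_prob_on_configs M" "translation_invariant M" "f \<in> borel_measurable config_space"
  shows "(\<integral>\<sigma>. f (shift (- i) \<sigma>) \<partial>M) = (\<integral>\<sigma>. f \<sigma> \<partial>M)"
proof -
  note s = is_prob_on_configsD(3)[OF assms(1)] and sp = is_prob_on_configsD(2)[OF assms(1)]
  have sb: "sets M = sets borel"
    using s sets_config_space by metis
  have sh: "shift (- i) \<in> measurable M M"
    using borel_measurable_continuous_onI[OF continuous_on_shift[of "- i"]] measurable_cong_sets[OF sb sb] by blast
  have f: "f \<in> borel_measurable M"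
    by (rule is_prob_on_configsD(4)[OF assms(1,3)])
  have "distr M M (shift (- i)) = M"
  proof (rule measure_eqI)
    fix B assume "B \<in> sets (distr M M (shift (- i)))"
    then show "emeasure (distr M M (shift (- i))) B = emeasure M B"
      using assms(2) by (simp add: emeasure_distr sh sp vimage_shift translation_invariant_def)
  qed simp
  then show ?thesis
    using integral_distr[OF sh f] by simp
qed

section \<open>Potentials and their boundary terms\<close>

text \<open>Subadditivity for overlapping families: removing \<open>P i\<close> from the union of
  the others makes the pieces disjoint and, as \<open>u\<close> is nonnegative, does not increase
  the sum. It later bounds sums over interaction sets by sums over sites.\<close>

lemma infsum_UN_le:
  fixes u :: "'b \<Rightarrow> real"
  assumes "finite I" "\<And>x. u x \<ge> 0" "\<And>i. i \<in> I \<Longrightarrow> u summable_on P i"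
  shows "u summable_on (\<Union>i\<in>I. P i)" "infsum u (\<Union>i\<in>I. P i) \<le> (\<Sum>i\<in>I. infsum u (P i))"
proof -
  have "u summable_on (\<Union>i\<in>I. P i) \<and> infsum u (\<Union>i\<in>I. P i) \<le> (\<Sum>i\<in>I. infsum u (P i))"
    using assms(1,3)
  proof (induction rule: finite_induct)
    case (insert i I)
    let ?Q = "\<Union>j\<in>I. P j"
    have i: "u summable_on P i" and Q: "u summable_on ?Q"
      and le: "infsum u ?Q \<le> (\<Sum>j\<in>I. infsum u (P j))"
      using insert by auto
    have D: "u summable_on (?Q - P i)"
      by (rule summable_on_subset_banach[OF Q]) auto
    have un: "(\<Union>j\<in>insert i I. P j) = P i \<union> (?Q - P i)"
      by auto
    have "infsum u (\<Union>j\<in>insert i I. P j) = infsum u (P i) + infsum u (?Q - P i)"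
      unfolding un by (rule infsum_Un_disjoint[OF i D]) auto
    also have "infsum u (?Q - P i) \<le> infsum u ?Q"
      by (rule infsum_mono2[OF D Q]) (use assms in auto)
    finally show ?case
      using le insert.hyps summable_on_Un_disjoint[OF i D] unfolding un by auto
  qed simp
  then show "u summable_on (\<Union>i\<in>I. P i)" "infsum u (\<Union>i\<in>I. P i) \<le> (\<Sum>i\<in>I. infsum u (P i))"
    by auto
qed

text \<open>The sup norm as a real number. \<open>enn2real\<close> would turn an infinite supremum
  into 0; \<open>SUP_less_top\<close> excludes this for finite nonempty sets.\<close>

definition potential_norm :: "('a, 'd::finite) potential \<Rightarrow> 'd site set \<Rightarrow> real" where
  "potential_norm U A = enn2real (SUP \<sigma>. ennreal \<bar>U A \<sigma>\<bar>)"

text \<open>Among the terms of the Hamiltonian in \<Lambda>, only sets meeting both \<Lambda> and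
  its complement feel the boundary condition.\<close>

definition boundary_norm :: "('a, 'd::finite) potential \<Rightarrow> 'd site set \<Rightarrow> real" where
  "boundary_norm U \<Lambda> = (\<Sum>\<^sub>\<infinity>A\<in>{A. finite A \<and> A \<inter> \<Lambda> \<noteq> {} \<and> \<not> A \<subseteq> \<Lambda>}. potential_norm U A)"

lemma potential_norm_nonneg [simp]: "potential_norm U A \<ge> 0"
  by (simp add: potential_norm_def)

text \<open>Moves families of interaction sets at site \<open>i\<close> to the origin, where
  summability is assumed. The restriction to sets leaving \<Lambda> is carried along so that
  boundary sums can be moved too.\<close>

lemma bij_betw_translate:
  "bij_betw (\<lambda>A. (\<lambda>j. j + i) ` A) {A. finite A \<and> 0 \<in> A \<and> \<not> (\<lambda>j. j + i) ` A \<subseteq> \<Lambda>}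
     {A. finite A \<and> i \<in> A \<and> \<not> A \<subseteq> (\<Lambda> :: 'd::finite site set)}"
proof (rule bij_betw_byWitness[where f' = "\<lambda>A. (\<lambda>j. j + - i) ` A"])
  show "(\<lambda>A. (\<lambda>j. j + i) ` A) ` {A. finite A \<and> 0 \<in> A \<and> \<not> (\<lambda>j. j + i) ` A \<subseteq> \<Lambda>}
     \<subseteq> {A. finite A \<and> i \<in> A \<and> \<not> A \<subseteq> \<Lambda>}"
  proof (rule image_subsetI)
    fix A assume A: "A \<in> {A. finite A \<and> 0 \<in> A \<and> \<not> (\<lambda>j. j + i) ` A \<subseteq> \<Lambda>}"
    then have "0 + i \<in> (\<lambda>j. j + i) ` A"
      by blast
    with A show "(\<lambda>j. j + i) ` A \<in> {A. finite A \<and> i \<in> A \<and> \<not> A \<subseteq> \<Lambda>}"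
      by (simp only: mem_Collect_eq finite_imageI add_0_left simp_thms)
  qed
  show "(\<lambda>A. (\<lambda>j. j + - i) ` A) ` {A. finite A \<and> i \<in> A \<and> \<not> A \<subseteq> \<Lambda>}
     \<subseteq> {A. finite A \<and> 0 \<in> A \<and> \<not> (\<lambda>j. j + i) ` A \<subseteq> \<Lambda>}"
    by (auto simp: image_image)
qed (simp_all add: image_image)

section \<open>Summability of a translation-invariant potential\<close>

locale uas_potential =
  fixes U :: "('a::second_countable_topology, 'd::finite) potential"
  assumes uas: "uas_ti_potential U"
begin

lemma depends_on_U: "finite A \<Longrightarrow> depends_on A (U A)"
  using uas depends_on_coord_algebra_measurable unfolding uas_ti_potential_def by blast

lemma continuous_on_U: "finite A \<Longrightarrow> continuous_on UNIV (U A)"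
  using uas unfolding uas_ti_potential_def by blast

lemma U_translate:
  "finite A \<Longrightarrow> U ((\<lambda>j. j + i) ` A) \<sigma> = U A (shift (- i) \<sigma>)"
proof -
  assume "finite A"
  then have "U ((\<lambda>j. j + i) ` A) (shift i (shift (- i) \<sigma>)) = U A (shift (- i) \<sigma>)"
    using uas unfolding uas_ti_potential_def by blast
  then show ?thesis by simp
qed

text \<open>Shifts map the configuration space onto itself, so both suprema run over the same
  values.\<close>

lemma potential_norm_translate:
  assumes "finite A"
  shows "(SUP \<sigma>. ennreal \<bar>U ((\<lambda>j. j + i) ` A) \<sigma>\<bar>) = (SUP \<sigma>. ennreal \<bar>U A \<sigma>\<bar>)"
    and "potential_norm U ((\<lambda>j. j + i) ` A) = potential_norm U A"
proof -
  have "range (\<lambda>\<sigma>. ennreal \<bar>U ((\<lambda>j. j + i) ` A) \<sigma>\<bar>) = (\<lambda>\<sigma>. ennreal \<bar>U A \<sigma>\<bar>) ` range (shift (- i))"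
    using assms by (simp add: U_translate image_image)
  then show "(SUP \<sigma>. ennreal \<bar>U ((\<lambda>j. j + i) ` A) \<sigma>\<bar>) = (SUP \<sigma>. ennreal \<bar>U A \<sigma>\<bar>)"
    by (simp only: surj_shift)
  then show "potential_norm U ((\<lambda>j. j + i) ` A) = potential_norm U A"
    by (simp only: potential_norm_def)
qed

text \<open>For a set containing the origin, the supremum is one term of a finite sum. Any other
  nonempty set is translated so that one of its sites becomes the origin.\<close>

lemma SUP_less_top:
  assumes "finite A" "A \<noteq> {}"
  shows "(SUP \<sigma>. ennreal \<bar>U A \<sigma>\<bar>) < \<infinity>"
proof -
  let ?s = "\<lambda>A. SUP \<sigma>. ennreal \<bar>U A \<sigma>\<bar>"
  have at_0: "?s B < \<infinity>" if "finite B" "0 \<in> B" for B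
  proof -
    have "?s B = infsum ?s {B}"
      by simp
    also have "\<dots> \<le> infsum ?s {A. finite A \<and> 0 \<in> A}"
      by (rule infsum_mono_neutral) (use that in \<open>auto intro: nonneg_summable_on_complete\<close>)
    also have "\<dots> < \<infinity>"
      using uas by (simp add: uas_ti_potential_def)
    finally show ?thesis .
  qed
  obtain i where i: "i \<in> A"
    using assms by blast
  have "?s ((\<lambda>j. j + - i) ` A) < \<infinity>"
    by (rule at_0) (use assms i in \<open>auto intro: image_eqI[of _ _ i]\<close>)
  then show ?thesis
    by (simp only: potential_norm_translate[OF assms(1)])
qed

lemma abs_le_potential_norm:
  assumes "finite A" "A \<noteq> {}"
  shows "\<bar>U A \<sigma>\<bar> \<le> potential_norm U A"
proof -
  have "ennreal \<bar>U A \<sigma>\<bar> \<le> (SUP \<sigma>. ennreal \<bar>U A \<sigma>\<bar>)"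
    by (rule SUP_upper) simp
  then have "enn2real (ennreal \<bar>U A \<sigma>\<bar>) \<le> potential_norm U A"
    unfolding potential_norm_def using SUP_less_top[OF assms] by (intro enn2real_mono) auto
  then show ?thesis by simp
qed

text \<open>The assumed bound is on a sum in [0,\<infinity>]; its finiteness bounds all finite
  partial sums of the real-valued norms.\<close>

lemma summable_at_0: "potential_norm U summable_on {A. finite A \<and> 0 \<in> A}"
proof (rule nonneg_bdd_above_summable_on)
  let ?s = "\<lambda>A. SUP \<sigma>. ennreal \<bar>U A \<sigma>\<bar>" and ?T = "{A. finite A \<and> 0 \<in> A}"
  have "sum (potential_norm U) F \<le> enn2real (infsum ?s ?T)" if F: "F \<subseteq> ?T" "finite F" for F
  proof -
    have "sum (potential_norm U) F = enn2real (sum ?s F)"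
      unfolding potential_norm_def using F SUP_less_top by (subst enn2real_sum) auto
    also have "sum ?s F = infsum ?s F"
      using F by simp
    also have "enn2real \<dots> \<le> enn2real (infsum ?s ?T)"
    proof (rule enn2real_mono)
      show "infsum ?s F \<le> infsum ?s ?T"
        by (rule infsum_mono_neutral) (use F in \<open>auto intro: nonneg_summable_on_complete\<close>)
      show "infsum ?s ?T < \<top>"
        using uas by (simp add: uas_ti_potential_def)
    qed
    finally show ?thesis .
  qed
  then show "bdd_above (sum (potential_norm U) ` {F. F \<subseteq> ?T \<and> finite F})"
    by (auto intro!: bdd_aboveI2)
qed simp

text \<open>Follows by translating to the origin. \<open>T\<close> is left open for two uses: the
  family of all sets containing the origin bounds every site by one constant, and a tail of that
  family makes the contribution of interior sites small.\<close>

lemma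
  assumes "{A. finite A \<and> 0 \<in> A \<and> \<not> (\<lambda>j. j + i) ` A \<subseteq> \<Lambda>} \<subseteq> T" "T \<subseteq> {A. finite A \<and> 0 \<in> A}"
  shows site_summable: "potential_norm U summable_on {A. finite A \<and> i \<in> A \<and> \<not> A \<subseteq> \<Lambda>}"
    and site_infsum_le: "infsum (potential_norm U) {A. finite A \<and> i \<in> A \<and> \<not> A \<subseteq> \<Lambda>} \<le> infsum (potential_norm U) T"
proof -
  let ?S = "{A. finite A \<and> 0 \<in> A \<and> \<not> (\<lambda>j. j + i) ` A \<subseteq> \<Lambda>}"
  have T: "potential_norm U summable_on T"
    by (rule summable_on_subset_banach[OF summable_at_0 assms(2)])
  have S: "potential_norm U summable_on ?S"
    by (rule summable_on_subset_banach[OF T assms(1)])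
  have cong: "potential_norm U ((\<lambda>j. j + i) ` A) = potential_norm U A" if "A \<in> ?S" for A
    using that by (simp add: potential_norm_translate)
  show "potential_norm U summable_on {A. finite A \<and> i \<in> A \<and> \<not> A \<subseteq> \<Lambda>}"
    unfolding summable_on_reindex_bij_betw[OF bij_betw_translate, symmetric]
    using S by (subst summable_on_cong[OF cong])
  have "infsum (potential_norm U) {A. finite A \<and> i \<in> A \<and> \<not> A \<subseteq> \<Lambda>} = infsum (potential_norm U) ?S"
    unfolding infsum_reindex_bij_betw[OF bij_betw_translate, symmetric] by (rule infsum_cong[OF cong])
  also have "\<dots> \<le> infsum (potential_norm U) T"
    by (rule infsum_mono2[OF S T assms(1)]) simp
  finally show "infsum (potential_norm U) {A. finite A \<and> i \<in> A \<and> \<not> A \<subseteq> \<Lambda>} \<le> infsum (potential_norm U) T" .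
qed

lemma summable_touching:
  assumes "finite \<Lambda>"
  shows "potential_norm U summable_on {A. finite A \<and> A \<inter> \<Lambda> \<noteq> {}}"
proof -
  have "potential_norm U summable_on {A. finite A \<and> i \<in> A}" for i
  proof -
    \<comment> \<open>With \<Lambda> = {i}, the only set at \<open>i\<close> that is left out is
      \<open>{i}\<close> itself, which is then reinserted.\<close>
    have "potential_norm U summable_on {A. finite A \<and> i \<in> A \<and> \<not> A \<subseteq> {i}}"
      by (rule site_summable[where T = "{A. finite A \<and> 0 \<in> A}"]) auto
    then have "potential_norm U summable_on insert {i} {A. finite A \<and> i \<in> A \<and> \<not> A \<subseteq> {i}}"
      by (simp only: summable_on_insert_iff)
    then show ?thesis
      by (rule summable_on_subset_banach) auto
  qed
  then have "potential_norm U summable_on (\<Union>i\<in>\<Lambda>. {A. finite A \<and> i \<in> A})"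
    by (intro infsum_UN_le assms) auto
  also have "(\<Union>i\<in>\<Lambda>. {A. finite A \<and> i \<in> A}) = {A. finite A \<and> A \<inter> \<Lambda> \<noteq> {}}"
    by auto
  finally show ?thesis .
qed

lemma boundary_norm_le:
  assumes "finite \<Lambda>"
  shows "boundary_norm U \<Lambda> \<le> (\<Sum>i\<in>\<Lambda>. infsum (potential_norm U) {A. finite A \<and> i \<in> A \<and> \<not> A \<subseteq> \<Lambda>})"
proof -
  have un: "{A. finite A \<and> A \<inter> \<Lambda> \<noteq> {} \<and> \<not> A \<subseteq> \<Lambda>} = (\<Union>i\<in>\<Lambda>. {A. finite A \<and> i \<in> A \<and> \<not> A \<subseteq> \<Lambda>})"
    by auto
  show ?thesis
    unfolding boundary_norm_def un
  proof (rule infsum_UN_le(2)[OF assms potential_norm_nonneg])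
    show "potential_norm U summable_on {A. finite A \<and> i \<in> A \<and> \<not> A \<subseteq> \<Lambda>}" for i
      by (rule site_summable[OF _ order_refl]) auto
  qed
qed

text \<open>The Hamiltonian as a function of one full configuration, so that continuity and bounds
  can be proved before inside and boundary are separated.\<close>

definition energy :: "'d site set \<Rightarrow> ('a, 'd) config \<Rightarrow> real" where
  "energy \<Lambda> \<eta> = (\<Sum>\<^sub>\<infinity>A\<in>{A. finite A \<and> A \<inter> \<Lambda> \<noteq> {}}. U A \<eta>)"

lemma hamiltonian_eq_energy: "hamiltonian U \<Lambda> \<xi> \<sigma> = energy \<Lambda> (override_on \<xi> \<sigma> \<Lambda>)"
  by (simp add: hamiltonian_def energy_def)

lemma abs_summable_U:
  assumes "finite \<Lambda>"
  shows "(\<lambda>A. \<bar>U A \<eta>\<bar>) summable_on {A. finite A \<and> A \<inter> \<Lambda> \<noteq> {}}"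
proof (rule summable_on_comparison_test[OF summable_touching[OF assms]])
  show "\<bar>U A \<eta>\<bar> \<le> potential_norm U A" if "A \<in> {A. finite A \<and> A \<inter> \<Lambda> \<noteq> {}}" for A
    using that by (intro abs_le_potential_norm) auto
qed simp

lemma summable_U:
  assumes "finite \<Lambda>"
  shows "(\<lambda>A. U A \<eta>) summable_on {A. finite A \<and> A \<inter> \<Lambda> \<noteq> {}}"
  using abs_summable_U[OF assms, of \<eta>] unfolding real_norm_def[symmetric] by (rule abs_summable_summable)

text \<open>The finite partial sums are continuous and, by the Weierstrass M-test with the summable
  potential norms, converge uniformly.\<close>

lemma continuous_on_energy:
  assumes "finite \<Lambda>"
  shows "continuous_on UNIV (energy \<Lambda>)"
proof (rule uniform_limit_theorem)
  let ?X = "{A. finite A \<and> A \<inter> \<Lambda> \<noteq> {}}"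
  show "uniform_limit UNIV (\<lambda>F \<eta>. \<Sum>A\<in>F. U A \<eta>) (energy \<Lambda>) (finite_subsets_at_top ?X)"
    unfolding energy_def
    by (rule Weierstrass_m_test_general[OF _ summable_touching[OF assms]])
       (auto intro!: abs_le_potential_norm)
  show "\<forall>\<^sub>F F in finite_subsets_at_top ?X. continuous_on UNIV (\<lambda>\<eta>. \<Sum>A\<in>F. U A \<eta>)"
    by (intro eventually_finite_subsets_at_top_weakI continuous_on_sum continuous_on_U) auto
qed simp

lemma abs_energy_le:
  assumes "finite \<Lambda>"
  shows "\<bar>energy \<Lambda> \<eta>\<bar> \<le> infsum (potential_norm U) {A. finite A \<and> A \<inter> \<Lambda> \<noteq> {}}"
proof -
  have "\<bar>energy \<Lambda> \<eta>\<bar> \<le> (\<Sum>\<^sub>\<infinity>A\<in>{A. finite A \<and> A \<inter> \<Lambda> \<noteq> {}}. \<bar>U A \<eta>\<bar>)"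
    unfolding energy_def using norm_infsum_bound[of "\<lambda>A. U A \<eta>"] abs_summable_U[OF assms] by simp
  also have "\<dots> \<le> infsum (potential_norm U) {A. finite A \<and> A \<inter> \<Lambda> \<noteq> {}}"
    by (intro infsum_mono abs_summable_U summable_touching assms abs_le_potential_norm) auto
  finally show ?thesis .
qed

text \<open>Terms with \<open>A\<close> inside \<Lambda> do not see the boundary condition; every
  other term changes by at most twice its norm.\<close>

lemma hamiltonian_le:
  assumes "finite \<Lambda>"
  shows "hamiltonian U \<Lambda> \<xi> \<sigma> \<le> hamiltonian U \<Lambda> \<xi>' \<sigma> + 2 * boundary_norm U \<Lambda>"
proof -
  let ?X = "{A. finite A \<and> A \<inter> \<Lambda> \<noteq> {}}"
  let ?e = "\<lambda>A. if A \<subseteq> \<Lambda> then 0 else potential_norm U A"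
  have e: "?e summable_on ?X"
    by (rule summable_on_comparison_test[OF summable_touching[OF assms]]) auto
  have le: "U A (override_on \<xi> \<sigma> \<Lambda>) \<le> U A (override_on \<xi>' \<sigma> \<Lambda>) + 2 * ?e A" if "A \<in> ?X" for A
  proof (cases "A \<subseteq> \<Lambda>")
    case True
    have "U A (override_on \<xi> \<sigma> \<Lambda>) = U A (override_on \<xi>' \<sigma> \<Lambda>)"
      by (rule depends_onD[OF depends_on_U]) (use that True in \<open>auto simp: override_on_def\<close>)
    then show ?thesis using True by simp
  next
    case False
    have "A \<noteq> {}" "finite A" using that by auto
    from abs_le_potential_norm[OF this(2,1), of "override_on \<xi> \<sigma> \<Lambda>"]
      abs_le_potential_norm[OF this(2,1), of "override_on \<xi>' \<sigma> \<Lambda>"] False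
    show ?thesis by simp
  qed
  have "hamiltonian U \<Lambda> \<xi> \<sigma> \<le> (\<Sum>\<^sub>\<infinity>A\<in>?X. U A (override_on \<xi>' \<sigma> \<Lambda>) + 2 * ?e A)"
    unfolding hamiltonian_def
    by (intro infsum_mono summable_U summable_on_add summable_on_cmult_right e le assms)
  also have "\<dots> = hamiltonian U \<Lambda> \<xi>' \<sigma> + 2 * infsum ?e ?X"
    unfolding hamiltonian_def
    by (simp only: infsum_add[OF summable_U[OF assms] summable_on_cmult_right[OF e]] infsum_cmult_right'[symmetric])
  also have "infsum ?e ?X = boundary_norm U \<Lambda>"
    unfolding boundary_norm_def by (rule infsum_cong_neutral) auto
  finally show ?thesis .
qed

end

section \<open>Comparison of Gibbs measures on a finite volume\<close>

lemma integrable_bounded_config: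
  fixes M :: "('a::second_countable_topology, 'd::finite) config measure"
    and f :: "('a, 'd) config \<Rightarrow> real"
  assumes "is_prob_on_configs M" "f \<in> borel_measurable config_space" "bounded (range f)"
  shows "integrable M f"
proof -
  interpret prob_space M by (rule is_prob_on_configsD[OF assms(1)])
  obtain B where "\<And>\<sigma>. \<bar>f \<sigma>\<bar> \<le> B"
    using assms(3) unfolding bounded_iff by auto
  then show ?thesis
    using is_prob_on_configsD(4)[OF assms(1,2)] by (intro integrable_const_bound[of _ B]) auto
qed

lemma measurable_override_on:
  fixes lam :: "'a::topological_space measure" and \<Lambda> :: "'d::finite site set"
  assumes "sets lam = sets borel"
  shows "(\<lambda>\<sigma>. override_on \<xi> \<sigma> \<Lambda>) \<in> measurable (PiM \<Lambda> (\<lambda>_. lam)) config_space"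
  unfolding config_space_def override_on_def
proof (rule measurable_PiM_single')
  fix i
  show "(\<lambda>\<sigma>. if i \<in> \<Lambda> then \<sigma> i else \<xi> i) \<in> measurable (PiM \<Lambda> (\<lambda>_. lam)) borel"
  proof (cases "i \<in> \<Lambda>")
    case True
    have "(\<lambda>\<sigma>. \<sigma> i) \<in> measurable (PiM \<Lambda> (\<lambda>_. lam)) lam"
      using True by (rule measurable_component_singleton)
    then show ?thesis
      using True unfolding measurable_cong_sets[OF refl assms] by simp
  qed simp
qed auto

section \<open>Boltzmann weights and Gibbs kernels\<close>

context uas_potential
begin

context
  fixes lam :: "'a measure" and \<Lambda> :: "'d site set"
  assumes lam: "prob_space lam" "sets lam = sets borel" and fin: "finite \<Lambda>"
begin

lemma prob_space_PiM_lam: "prob_space (PiM \<Lambda> (\<lambda>_. lam))"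
  by (intro prob_space_PiM lam)

lemma measurable_hamiltonian: "hamiltonian U \<Lambda> \<xi> \<in> borel_measurable (PiM \<Lambda> (\<lambda>_. lam))"
  unfolding hamiltonian_eq_energy
  by (rule measurable_compose[OF measurable_override_on[OF lam(2)]
        borel_measurable_continuous_config[OF continuous_on_energy[OF fin]]])

lemma integrable_boltzmann:
  fixes g :: "('a, 'd) config \<Rightarrow> real"
  assumes "g \<in> borel_measurable config_space" "bounded (range g)"
  shows "integrable (PiM \<Lambda> (\<lambda>_. lam)) (\<lambda>\<sigma>. exp (- hamiltonian U \<Lambda> \<xi> \<sigma>) * g (override_on \<xi> \<sigma> \<Lambda>))"
proof -
  interpret P: prob_space "PiM \<Lambda> (\<lambda>_. lam)" by (rule prob_space_PiM_lam)
  obtain B where B: "\<And>\<sigma>. \<bar>g \<sigma>\<bar> \<le> B"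
    using assms(2) unfolding bounded_iff by auto
  let ?E = "infsum (potential_norm U) {A. finite A \<and> A \<inter> \<Lambda> \<noteq> {}}"
  note [measurable] = measurable_hamiltonian[of \<xi>]
    measurable_compose[OF measurable_override_on[OF lam(2)] assms(1), of \<xi> \<Lambda>]
  show ?thesis
  proof (rule P.integrable_const_bound[of _ "exp ?E * B"])
    have "\<bar>exp (- hamiltonian U \<Lambda> \<xi> \<sigma>) * g (override_on \<xi> \<sigma> \<Lambda>)\<bar> \<le> exp ?E * B" for \<sigma>
      using abs_energy_le[OF fin, of "override_on \<xi> \<sigma> \<Lambda>"] B
      unfolding abs_mult hamiltonian_eq_energy by (intro mult_mono) auto
    then show "AE \<sigma> in PiM \<Lambda> (\<lambda>_. lam). norm (exp (- hamiltonian U \<Lambda> \<xi> \<sigma>) * g (override_on \<xi> \<sigma> \<Lambda>)) \<le> exp ?E * B"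
      by simp
  qed measurable
qed

lemma integrable_exp_hamiltonian: "integrable (PiM \<Lambda> (\<lambda>_. lam)) (\<lambda>\<sigma>. exp (- hamiltonian U \<Lambda> \<xi> \<sigma>))"
  using integrable_boltzmann[of "\<lambda>_. 1"] by simp

text \<open>The energy is bounded, so the Boltzmann weight stays above a positive constant, and the
  reference measure has mass one.\<close>

lemma partition_function_pos: "partition_function lam U \<Lambda> \<xi> > 0"
proof -
  interpret P: prob_space "PiM \<Lambda> (\<lambda>_. lam)" by (rule prob_space_PiM_lam)
  let ?E = "infsum (potential_norm U) {A. finite A \<and> A \<inter> \<Lambda> \<noteq> {}}"
  have "exp (- ?E) = (\<integral>\<sigma>. exp (- ?E) \<partial>PiM \<Lambda> (\<lambda>_. lam))"
    using P.prob_space by simp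
  also have "\<dots> \<le> partition_function lam U \<Lambda> \<xi>"
    unfolding partition_function_def
  proof (rule integral_mono[OF _ integrable_exp_hamiltonian])
    show "exp (- ?E) \<le> exp (- hamiltonian U \<Lambda> \<xi> \<sigma>)" for \<sigma>
      using abs_energy_le[OF fin, of "override_on \<xi> \<sigma> \<Lambda>"] by (simp add: hamiltonian_eq_energy)
  qed simp
  finally show ?thesis
    using exp_gt_zero less_le_trans by blast
qed

lemma integral_gibbs_kernel:
  fixes g :: "('a, 'd) config \<Rightarrow> real"
  assumes "g \<in> borel_measurable config_space"
  shows "(\<integral>\<sigma>. g (override_on \<xi> \<sigma> \<Lambda>) \<partial>gibbs_kernel lam U \<Lambda> \<xi>) =
    (\<integral>\<sigma>. exp (- hamiltonian U \<Lambda> \<xi> \<sigma>) * g (override_on \<xi> \<sigma> \<Lambda>) \<partial>PiM \<Lambda> (\<lambda>_. lam)) / partition_function lam U \<Lambda> \<xi>"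
proof -
  note [measurable] = measurable_hamiltonian[of \<xi>]
    measurable_compose[OF measurable_override_on[OF lam(2)] assms, of \<xi> \<Lambda>]
  have "(\<integral>\<sigma>. g (override_on \<xi> \<sigma> \<Lambda>) \<partial>gibbs_kernel lam U \<Lambda> \<xi>) =
    (\<integral>\<sigma>. (exp (- hamiltonian U \<Lambda> \<xi> \<sigma>) / partition_function lam U \<Lambda> \<xi>) *\<^sub>R g (override_on \<xi> \<sigma> \<Lambda>) \<partial>PiM \<Lambda> (\<lambda>_. lam))"
    unfolding gibbs_kernel_def
    by (rule integral_density) (use partition_function_pos[of \<xi>] in auto)
  also have "\<dots> = (\<integral>\<sigma>. exp (- hamiltonian U \<Lambda> \<xi> \<sigma>) * g (override_on \<xi> \<sigma> \<Lambda>) / partition_function lam U \<Lambda> \<xi> \<partial>PiM \<Lambda> (\<lambda>_. lam))"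
    by (intro Bochner_Integration.integral_cong) auto
  finally show ?thesis by simp
qed

text \<open>A change of boundary condition costs a factor \<open>exp (2 * ?b)\<close> in the
  numerator and another one in the partition function; hence the 4.\<close>

lemma integral_gibbs_kernel_le:
  fixes g :: "('a, 'd) config \<Rightarrow> real"
  assumes g: "g \<in> borel_measurable config_space" "bounded (range g)" "depends_on \<Lambda> g" "\<And>\<sigma>. g \<sigma> \<ge> 0"
  shows "(\<integral>\<sigma>. g (override_on \<xi> \<sigma> \<Lambda>) \<partial>gibbs_kernel lam U \<Lambda> \<xi>) \<le>
    exp (4 * boundary_norm U \<Lambda>) * (\<integral>\<sigma>. g (override_on \<xi>' \<sigma> \<Lambda>) \<partial>gibbs_kernel lam U \<Lambda> \<xi>')"
proof -
  let ?b = "boundary_norm U \<Lambda>"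
  define N where "N \<xi> = (\<integral>\<sigma>. exp (- hamiltonian U \<Lambda> \<xi> \<sigma>) * g (override_on \<xi> \<sigma> \<Lambda>) \<partial>PiM \<Lambda> (\<lambda>_. lam))" for \<xi>
  define Z where "Z = partition_function lam U \<Lambda>"
  have boltzmann: "exp (- hamiltonian U \<Lambda> \<xi> \<sigma>) \<le> exp (2 * ?b) * exp (- hamiltonian U \<Lambda> \<xi>' \<sigma>)" for \<xi> \<xi>' \<sigma>
    using hamiltonian_le[OF fin, of \<xi>' \<sigma> \<xi>] by (simp flip: exp_add)
  \<comment> \<open>Since \<open>g\<close> reads only \<Lambda>, the boundary condition enters
    through the weights alone.\<close>
  have geq: "g (override_on \<xi> \<sigma> \<Lambda>) = g (override_on \<xi>' \<sigma> \<Lambda>)" for \<sigma>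
    by (rule depends_onD[OF g(3)]) auto
  have "N \<xi> \<le> (\<integral>\<sigma>. exp (2 * ?b) * (exp (- hamiltonian U \<Lambda> \<xi>' \<sigma>) * g (override_on \<xi>' \<sigma> \<Lambda>)) \<partial>PiM \<Lambda> (\<lambda>_. lam))"
    unfolding N_def
  proof (intro integral_mono integrable_boltzmann integrable_mult_right g)
    fix \<sigma>
    show "exp (- hamiltonian U \<Lambda> \<xi> \<sigma>) * g (override_on \<xi> \<sigma> \<Lambda>)
        \<le> exp (2 * ?b) * (exp (- hamiltonian U \<Lambda> \<xi>' \<sigma>) * g (override_on \<xi>' \<sigma> \<Lambda>))"
      using mult_right_mono[OF boltzmann[of \<xi> \<sigma> \<xi>'] g(4)[of "override_on \<xi>' \<sigma> \<Lambda>"]]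
      by (simp only: geq mult.assoc)
  qed
  then have N: "N \<xi> \<le> exp (2 * ?b) * N \<xi>'"
    unfolding N_def by simp
  have "Z \<xi>' \<le> (\<integral>\<sigma>. exp (2 * ?b) * exp (- hamiltonian U \<Lambda> \<xi> \<sigma>) \<partial>PiM \<Lambda> (\<lambda>_. lam))"
    unfolding Z_def partition_function_def
    by (intro integral_mono integrable_exp_hamiltonian integrable_mult_right boltzmann)
  then have Z: "Z \<xi>' \<le> exp (2 * ?b) * Z \<xi>"
    unfolding Z_def partition_function_def by simp
  have pos: "Z \<xi> > 0" "Z \<xi>' > 0"
    unfolding Z_def by (rule partition_function_pos)+
  have N': "N \<xi>' \<ge> 0"
    unfolding N_def by (intro integral_nonneg_AE) (use g(4) in auto)
  have "N \<xi> * Z \<xi>' \<le> (exp (2 * ?b) * N \<xi>') * (exp (2 * ?b) * Z \<xi>)"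
    by (rule mult_mono[OF N Z]) (use pos N' in auto)
  also have "\<dots> = exp (4 * ?b) * N \<xi>' * Z \<xi>"
    by (simp add: exp_double[of "2 * ?b", simplified] power2_eq_square)
  finally have "N \<xi> / Z \<xi> \<le> exp (4 * ?b) * (N \<xi>' / Z \<xi>')"
    using pos by (simp add: field_simps)
  then show ?thesis
    unfolding integral_gibbs_kernel[OF g(1)] N_def Z_def .
qed

text \<open>The kernels are compared at two unrelated boundary conditions, so one can be averaged
  under \<nu> with the other fixed, and the latter then under \<mu>.\<close>

lemma gibbs_integral_le:
  fixes g :: "('a, 'd) config \<Rightarrow> real"
  assumes gibbs: "is_gibbs lam U \<mu>" "is_gibbs lam U \<nu>"
    and g: "g \<in> borel_measurable config_space" "bounded (range g)" "depends_on \<Lambda> g" "\<And>\<sigma>. g \<sigma> \<ge> 0"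
  shows "(\<integral>\<sigma>. g \<sigma> \<partial>\<nu>) \<le> exp (4 * boundary_norm U \<Lambda>) * (\<integral>\<sigma>. g \<sigma> \<partial>\<mu>)"
proof -
  define q where "q \<xi> = (\<integral>\<sigma>. g (override_on \<xi> \<sigma> \<Lambda>) \<partial>gibbs_kernel lam U \<Lambda> \<xi>)" for \<xi>
  let ?c = "exp (4 * boundary_norm U \<Lambda>)"
  have q: "q \<xi> \<le> ?c * q \<xi>'" for \<xi> \<xi>'
    unfolding q_def by (rule integral_gibbs_kernel_le[OF g])
  have cond: "AE \<xi> in M. real_cond_exp M (coord_algebra (- \<Lambda>)) g \<xi> = q \<xi>"
    if "is_gibbs lam U M" for M
    using that g fin unfolding is_gibbs_def q_def by blast
  \<comment> \<open>The integrals below are of conditional expectations, which are integrable,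
    rather than of \<open>q\<close>, whose measurability would need its own argument.\<close>
  have int: "integrable M (real_cond_exp M (coord_algebra (- \<Lambda>)) g)"
    "(\<integral>\<sigma>. real_cond_exp M (coord_algebra (- \<Lambda>)) g \<sigma> \<partial>M) = (\<integral>\<sigma>. g \<sigma> \<partial>M)"
    if "is_gibbs lam U M" for M
  proof -
    have M: "is_prob_on_configs M"
      using that by (simp add: is_gibbs_def)
    interpret prob_space M by (rule is_prob_on_configsD[OF M])
    interpret finite_measure_subalgebra M "coord_algebra (- \<Lambda>)"
      by unfold_locales (rule subalgebra_coord_algebra[OF M])
    show "integrable M (real_cond_exp M (coord_algebra (- \<Lambda>)) g)"
      "(\<integral>\<sigma>. real_cond_exp M (coord_algebra (- \<Lambda>)) g \<sigma> \<partial>M) = (\<integral>\<sigma>. g \<sigma> \<partial>M)"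
      by (rule real_cond_exp_int[OF integrable_bounded_config[OF M g(1,2)]])+
  qed
  interpret \<mu>: prob_space \<mu>
    using gibbs is_prob_on_configsD(1) unfolding is_gibbs_def by blast
  interpret \<nu>: prob_space \<nu>
    using gibbs is_prob_on_configsD(1) unfolding is_gibbs_def by blast
  have "(\<integral>\<sigma>. g \<sigma> \<partial>\<nu>) \<le> ?c * q \<xi>'" for \<xi>'
  proof -
    have "(\<integral>\<sigma>. g \<sigma> \<partial>\<nu>) = (\<integral>\<sigma>. real_cond_exp \<nu> (coord_algebra (- \<Lambda>)) g \<sigma> \<partial>\<nu>)"
      using int(2)[OF gibbs(2)] by simp
    also have "\<dots> \<le> (\<integral>\<sigma>. ?c * q \<xi>' \<partial>\<nu>)"
      by (intro integral_mono_AE int gibbs) (use cond[OF gibbs(2)] q in auto)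
    finally show ?thesis
      using \<nu>.prob_space by simp
  qed
  then have "AE \<xi>' in \<mu>. (\<integral>\<sigma>. g \<sigma> \<partial>\<nu>) \<le> ?c * real_cond_exp \<mu> (coord_algebra (- \<Lambda>)) g \<xi>'"
    using cond[OF gibbs(1)] by auto
  then have "(\<integral>\<xi>'. (\<integral>\<sigma>. g \<sigma> \<partial>\<nu>) \<partial>\<mu>) \<le> (\<integral>\<xi>'. ?c * real_cond_exp \<mu> (coord_algebra (- \<Lambda>)) g \<xi>' \<partial>\<mu>)"
    by (intro integral_mono_AE integrable_mult_right int gibbs) auto
  then show ?thesis
    using \<mu>.prob_space int(2)[OF gibbs(1)] by simp
qed

text \<open>The comparison of measures is applied to \<open>exp (f - m)\<close>: its \<nu>-mean is
  bounded below by convexity and its \<mu>-mean above by \<open>GCB\<close>. Taking logarithms turns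
  the factors into the two summands.\<close>

lemma gibbs_mean_difference_le:
  fixes f :: "('a, 'd) config \<Rightarrow> real"
  assumes gibbs: "is_gibbs lam U \<mu>" "is_gibbs lam U \<nu>" and gcb: "GCB \<mu> C"
    and f: "local_fun f" "bounded (range f)" "depends_on \<Lambda> f"
  shows "(\<integral>\<sigma>. f \<sigma> \<partial>\<nu>) - (\<integral>\<sigma>. f \<sigma> \<partial>\<mu>) \<le> 4 * boundary_norm U \<Lambda> + C / 2 * enn2real (osc_norm_sq f)"
proof -
  define m where "m = (\<integral>\<sigma>. f \<sigma> \<partial>\<mu>)"
  have P\<nu>: "is_prob_on_configs \<nu>"
    using gibbs by (simp add: is_gibbs_def)
  interpret \<nu>: prob_space \<nu> by (rule is_prob_on_configsD[OF P\<nu>])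
  have fm: "f \<in> borel_measurable config_space"
    using f by (intro borel_measurable_continuous_config) (simp add: local_fun_def)
  obtain B where B: "\<And>\<sigma>. \<bar>f \<sigma>\<bar> \<le> B"
    using f(2) unfolding bounded_iff by auto
  define g where "g \<sigma> = exp (f \<sigma> - m)" for \<sigma>
  have g: "g \<in> borel_measurable config_space" "depends_on \<Lambda> g"
    using fm f(3) unfolding g_def depends_on_def by (measurable, metis)
  have gb: "bounded (range g)"
    unfolding bounded_iff g_def using abs_le_D1[OF B] by (auto intro!: exI[of _ "exp (B - m)"])
  define y where "y = (\<integral>\<sigma>. f \<sigma> \<partial>\<nu>)"
  have fi: "integrable \<nu> f"
    by (rule integrable_bounded_config[OF P\<nu> fm f(2)])
  \<comment> \<open>Jensen's inequality by the tangent line of \<open>exp\<close> at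
    \<open>y - m\<close>: its linear part has \<nu>-mean zero, because \<open>y\<close> is the
    \<nu>-mean of \<open>f\<close>.\<close>
  have "exp (y - m) = (\<integral>\<sigma>. exp (y - m) * (1 + (f \<sigma> - y)) \<partial>\<nu>)"
    using fi \<nu>.prob_space by (simp add: y_def)
  also have "\<dots> \<le> (\<integral>\<sigma>. g \<sigma> \<partial>\<nu>)"
  proof (rule integral_mono)
    show "integrable \<nu> (\<lambda>\<sigma>. exp (y - m) * (1 + (f \<sigma> - y)))"
      using fi by simp
    show "integrable \<nu> g"
      by (rule integrable_bounded_config[OF P\<nu> g(1) gb])
    show "exp (y - m) * (1 + (f \<sigma> - y)) \<le> g \<sigma>" for \<sigma>
      using mult_left_mono[OF exp_ge_add_one_self[of "f \<sigma> - y"], of "exp (y - m)"]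
      by (simp add: g_def flip: exp_add)
  qed
  also have "\<dots> \<le> exp (4 * boundary_norm U \<Lambda>) * (\<integral>\<sigma>. g \<sigma> \<partial>\<mu>)"
    by (rule gibbs_integral_le[OF gibbs g(1) gb g(2)]) (simp add: g_def)
  also have "\<dots> \<le> exp (4 * boundary_norm U \<Lambda>) * exp (C / 2 * enn2real (osc_norm_sq f))"
    using gcb f unfolding GCB_def g_def m_def by (intro mult_left_mono) auto
  finally have "exp (y - m) \<le> exp (4 * boundary_norm U \<Lambda> + C / 2 * enn2real (osc_norm_sq f))"
    by (simp add: exp_add)
  then show ?thesis
    by (simp add: y_def m_def)
qed

end
end

section \<open>Sums over boxes\<close>

definition box_sites :: "nat \<Rightarrow> 'd::finite site set" where
  "box_sites n = {i. \<forall>k. \<bar>i $ k\<bar> \<le> int n}"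

lemma card_box_sites: "finite (box_sites n :: 'd::finite site set)"
  "card (box_sites n :: 'd site set) = (2 * n + 1) ^ CARD('d)"
proof -
  let ?P = "PiE (UNIV :: 'd set) (\<lambda>_. {- int n..int n})"
  have eq: "(box_sites n :: 'd site set) = vec_lambda ` ?P"
  proof
    show "(box_sites n :: 'd site set) \<subseteq> vec_lambda ` ?P"
    proof
      fix i :: "'d site" assume "i \<in> box_sites n"
      then have "vec_nth i \<in> ?P"
        by (auto simp: box_sites_def PiE_UNIV_domain abs_le_iff minus_le_iff)
      then show "i \<in> vec_lambda ` ?P"
        by (intro image_eqI[of _ _ "vec_nth i"]) auto
    qed
  qed (auto simp: box_sites_def PiE_UNIV_domain abs_le_iff minus_le_iff Pi_iff)
  have inj: "inj_on vec_lambda ?P"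
    by (intro inj_onI) (simp add: vec_lambda_inject)
  show "finite (box_sites n :: 'd site set)"
    unfolding eq by (intro finite_imageI finite_PiE) auto
  have "card ?P = (2 * n + 1) ^ CARD('d)"
    by (subst card_PiE) (auto simp: nat_add_distrib nat_mult_distrib)
  then show "card (box_sites n :: 'd site set) = (2 * n + 1) ^ CARD('d)"
    unfolding eq by (subst card_image[OF inj])
qed

lemma box_sites_mono: "m \<le> n \<Longrightarrow> box_sites m \<subseteq> box_sites n"
  unfolding box_sites_def by (auto intro: order_trans)

lemma add_box_sites:
  assumes "i \<in> box_sites m" "j \<in> box_sites n"
  shows "i + j \<in> box_sites (m + n)"
proof -
  have "\<bar>i $ k + j $ k\<bar> \<le> int m + int n" for k
    using assms abs_triangle_ineq[of "i $ k" "j $ k"] unfolding box_sites_def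
    by (smt (verit) mem_Collect_eq)
  then show ?thesis
    by (simp add: box_sites_def)
qed

lemma finite_subset_box_sites:
  assumes "finite A"
  obtains n where "A \<subseteq> box_sites n"
proof -
  have "\<exists>n. A \<subseteq> box_sites n"
    using assms
  proof induction
    case (insert i A)
    then obtain n where n: "A \<subseteq> box_sites n" by blast
    let ?m = "Max (range (\<lambda>k. nat \<bar>i $ k\<bar>))"
    have "nat \<bar>i $ k\<bar> \<le> ?m" for k
      by (rule Max_ge) auto
    then have "i \<in> box_sites ?m"
      by (simp add: box_sites_def nat_le_iff)
    with n have "insert i A \<subseteq> box_sites (max n ?m)"
      using box_sites_mono[of n "max n ?m"] box_sites_mono[of ?m "max n ?m"] by auto
    then show ?case by blast
  qed simp
  then show ?thesis using that by blast
qed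

text \<open>A collar of fixed width \<open>R\<close> is negligible against the volume: the ratio of
  side lengths tends to 1, hence so does its power.\<close>

lemma tendsto_card_box_sites_ratio:
  "(\<lambda>n. real (card (box_sites (n + R) :: 'd::finite site set)) / real (card (box_sites n :: 'd site set)))
     \<longlonglongrightarrow> 1"
proof -
  have "(\<lambda>n. real (2 * (n + R) + 1) / real (2 * n + 1)) \<longlonglongrightarrow> 1"
    by real_asymp
  from tendsto_power[OF this, of "CARD('d)"] show ?thesis
    by (simp add: card_box_sites power_divide)
qed

context uas_potential
begin

text \<open>The outer box is split into the inner box and a collar. A set that leaves the outer box
  from an inner site is, after translation to the origin, in a tail of total norm at most
  \<epsilon>; a collar site costs at most \<open>K\<close>.\<close>

lemma boundary_norm_box_sites_le:
  fixes \<epsilon> :: real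
  assumes "\<epsilon> > 0"
  defines "K \<equiv> infsum (potential_norm U) {A. finite A \<and> 0 \<in> A}"
  obtains R\<^sub>0 where "\<And>R n. R \<ge> R\<^sub>0 \<Longrightarrow> boundary_norm U (box_sites (n + R)) \<le>
     \<epsilon> * card (box_sites n :: 'd site set) +
     K * (real (card (box_sites (n + R) :: 'd site set)) - card (box_sites n :: 'd site set))"
proof -
  let ?T = "{A :: 'd site set. finite A \<and> 0 \<in> A}"
  \<comment> \<open>\<open>F\<close> collects finitely many interaction sets carrying all of
    \<open>K\<close> up to \<epsilon>; \<open>R\<^sub>0\<close> below is a radius whose box contains
    all of them.\<close>
  obtain F where F: "finite F" "F \<subseteq> ?T" "dist (sum (potential_norm U) F) K \<le> \<epsilon>"
    using infsum_finite_approximation[OF summable_at_0 \<open>\<epsilon> > 0\<close>] unfolding K_def by blast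
  have D: "potential_norm U summable_on (?T - F)"
    by (rule summable_on_subset_banach[OF summable_at_0]) auto
  have "infsum (potential_norm U) (F \<union> (?T - F)) = sum (potential_norm U) F + infsum (potential_norm U) (?T - F)"
    using F(1) by (subst infsum_Un_disjoint[OF _ D]) auto
  moreover have "F \<union> (?T - F) = ?T"
    using F(2) by blast
  ultimately have tail: "infsum (potential_norm U) (?T - F) \<le> \<epsilon>"
    using F(3) by (simp add: K_def dist_real_def)
  have "finite (\<Union>F)"
    using F by blast
  then obtain R\<^sub>0 where R\<^sub>0: "\<Union>F \<subseteq> box_sites R\<^sub>0"
    by (rule finite_subset_box_sites)
  show ?thesis
  proof (rule that)
    fix R n assume R: "R\<^sub>0 \<le> R"
    let ?W = "box_sites (n + R) :: 'd site set" and ?I = "box_sites n :: 'd site set"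
    let ?s = "\<lambda>i. infsum (potential_norm U) {A. finite A \<and> i \<in> A \<and> \<not> A \<subseteq> ?W}"
    have sub: "?I \<subseteq> ?W"
      by (rule box_sites_mono) simp
    have inner: "?s i \<le> \<epsilon>" if i: "i \<in> ?I" for i
    proof -
      have "(\<lambda>j. j + i) ` A \<subseteq> ?W" if "A \<in> F" for A
      proof
        fix k assume "k \<in> (\<lambda>j. j + i) ` A"
        then obtain j where j: "j \<in> A" "k = i + j"
          by (auto simp: add.commute)
        then have "j \<in> box_sites R"
          using R\<^sub>0 that box_sites_mono[OF R] by blast
        then show "k \<in> ?W"
          unfolding j(2) by (rule add_box_sites[OF i])
      qed
      then have "{A. finite A \<and> 0 \<in> A \<and> \<not> (\<lambda>j. j + i) ` A \<subseteq> ?W} \<subseteq> ?T - F"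
        by blast
      then have "?s i \<le> infsum (potential_norm U) (?T - F)"
        by (rule site_infsum_le) auto
      with tail show ?thesis by simp
    qed
    have outer: "?s i \<le> K" for i
      unfolding K_def by (rule site_infsum_le) auto
    have "boundary_norm U ?W \<le> (\<Sum>i\<in>?W. ?s i)"
      by (rule boundary_norm_le) (rule card_box_sites)
    also have "\<dots> = (\<Sum>i\<in>?W - ?I. ?s i) + (\<Sum>i\<in>?I. ?s i)"
      by (rule sum.subset_diff[OF sub]) (rule card_box_sites)
    also have "\<dots> \<le> (\<Sum>i\<in>?W - ?I. K) + (\<Sum>i\<in>?I. \<epsilon>)"
      by (intro add_mono sum_mono inner outer)
    also have "\<dots> = \<epsilon> * card ?I + K * (real (card ?W) - card ?I)"
      using card_mono[OF card_box_sites(1) sub]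
      by (simp add: card_Diff_subset[OF card_box_sites(1) sub] of_nat_diff mult.commute)
    finally show "boundary_norm U ?W \<le> \<epsilon> * card ?I + K * (real (card ?W) - card ?I)" .
  qed
qed

end

section \<open>Oscillation of sums of translates\<close>

lemma depends_on_shift_sum:
  fixes f :: "('a, 'd::finite) config \<Rightarrow> real"
  assumes "depends_on D f"
  shows "depends_on (\<Union>i\<in>I. (\<lambda>j. j + i) ` D) (\<lambda>\<sigma>. t * (\<Sum>i\<in>I. f (shift (- i) \<sigma>)))"
  unfolding depends_on_def
proof (intro allI impI)
  fix \<sigma> \<eta> :: "('a, 'd) config"
  assume eq: "\<forall>k\<in>(\<Union>i\<in>I. (\<lambda>j. j + i) ` D). \<sigma> k = \<eta> k"
  have "f (shift (- i) \<sigma>) = f (shift (- i) \<eta>)" if "i \<in> I" for i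
    by (rule depends_onD[OF assms]) (use eq that in \<open>auto simp: shift_def\<close>)
  then show "t * (\<Sum>i\<in>I. f (shift (- i) \<sigma>)) = t * (\<Sum>i\<in>I. f (shift (- i) \<eta>))"
    by simp
qed

text \<open>A site influences at most \<open>card D\<close> of the translates of a function of the coordinates in \<open>D\<close>.\<close>

lemma osc_norm_sq_shift_sum_le:
  fixes f :: "('a, 'd::finite) config \<Rightarrow> real"
  assumes D: "depends_on D f" "finite D" and I: "finite I" and B: "\<And>\<sigma>. \<bar>f \<sigma>\<bar> \<le> B" and t: "t \<ge> 0"
  shows "enn2real (osc_norm_sq (\<lambda>\<sigma>. t * (\<Sum>i\<in>I. f (shift (- i) \<sigma>))))
    \<le> real (card I) * (real (card D) * (2 * B * real (card D))\<^sup>2) * t\<^sup>2"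
proof -
  let ?J = "\<Union>i\<in>I. (\<lambda>j. j + i) ` D" and ?c = "2 * B * real (card D)"
  have B0: "B \<ge> 0"
    using B[of undefined] by linarith
  have "enn2real (osc_norm_sq (\<lambda>\<sigma>. t * (\<Sum>i\<in>I. f (shift (- i) \<sigma>)))) \<le> real (card ?J) * (t * ?c)\<^sup>2"
  proof (rule osc_norm_sq_le[OF depends_on_shift_sum[OF D(1)]])
    fix k and \<sigma> \<eta> :: "('a, 'd) config"
    assume eq: "\<And>j. j \<noteq> k \<Longrightarrow> \<sigma> j = \<eta> j"
    let ?d = "\<lambda>i. f (shift (- i) \<sigma>) - f (shift (- i) \<eta>)"
    \<comment> \<open>The translate by \<open>i\<close> reads the sites \<open>j + i\<close> with
      \<open>j\<close> in \<open>D\<close>; site \<open>k\<close> is among them exactly when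
      \<open>i\<close> lies in \<open>?V\<close>.\<close>
    let ?V = "(\<lambda>j. k - j) ` D"
    have "(\<Sum>i\<in>I. ?d i) = (\<Sum>i\<in>I \<inter> ?V. ?d i)"
    proof (rule sum.mono_neutral_right[OF I])
      show "\<forall>i\<in>I - I \<inter> ?V. ?d i = 0"
      proof
        fix i assume i: "i \<in> I - I \<inter> ?V"
        have "f (shift (- i) \<sigma>) = f (shift (- i) \<eta>)"
        proof (rule depends_onD[OF D(1)])
          fix j assume "j \<in> D"
          with i have "j + i \<noteq> k" by (auto simp: image_iff)
          then show "shift (- i) \<sigma> j = shift (- i) \<eta> j"
            by (simp add: shift_def eq)
        qed
        then show "?d i = 0" by simp
      qed
    qed auto
    also have "\<dots> \<le> (\<Sum>i\<in>I \<inter> ?V. 2 * B)"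
    proof (rule sum_mono)
      show "?d i \<le> 2 * B" for i
        using B[of "shift (- i) \<sigma>"] B[of "shift (- i) \<eta>"] by linarith
    qed
    also have "\<dots> = 2 * B * real (card (I \<inter> ?V))"
      by simp
    also have "\<dots> \<le> ?c"
    proof -
      have "card (I \<inter> ?V) \<le> card ?V"
        using D(2) by (intro card_mono) auto
      also have "\<dots> \<le> card D"
        by (rule card_image_le[OF D(2)])
      finally show ?thesis
        using B0 by (intro mult_left_mono) auto
    qed
    finally have "t * (\<Sum>i\<in>I. ?d i) \<le> t * ?c"
      using t by (rule mult_left_mono)
    then show "t * (\<Sum>i\<in>I. f (shift (- i) \<sigma>)) - t * (\<Sum>i\<in>I. f (shift (- i) \<eta>)) \<le> t * ?c"
      by (simp add: sum_subtractf right_diff_distrib)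
  qed (use D I t B0 in auto)
  also have "card ?J \<le> card I * card D"
  proof -
    have "card ?J \<le> (\<Sum>i\<in>I. card ((\<lambda>j. j + i) ` D))"
      by (rule card_UN_le[OF I])
    also have "\<dots> \<le> (\<Sum>i\<in>I. card D)"
      by (intro sum_mono card_image_le D)
    finally show ?thesis by simp
  qed
  then have "real (card ?J) * (t * ?c)\<^sup>2 \<le> real (card I * card D) * (t * ?c)\<^sup>2"
    by (intro mult_right_mono) (auto simp only: of_nat_le_iff zero_le_power2)
  finally show ?thesis
    by (simp add: power_mult_distrib mult_ac)
qed

section \<open>Equality of means of local functions\<close>

context uas_potential
begin

lemma gibbs_local_mean_le:
  fixes f :: "('a, 'd) config \<Rightarrow> real"
  assumes lam: "prob_space lam" "sets lam = sets borel"
    and \<mu>: "\<mu> \<in> ti_gibbs_measures lam U" and \<nu>: "\<nu> \<in> ti_gibbs_measures lam U"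
    and C_pos: "C > 0" and gcb: "GCB \<mu> C" and f: "local_fun f" "bounded (range f)"
  shows "(\<integral>\<sigma>. f \<sigma> \<partial>\<nu>) \<le> (\<integral>\<sigma>. f \<sigma> \<partial>\<mu>)"
proof -
  define a where "a = (\<integral>\<sigma>. f \<sigma> \<partial>\<nu>) - (\<integral>\<sigma>. f \<sigma> \<partial>\<mu>)"
  define D where "D = {i. oscillation i f \<noteq> 0}"
  have D: "finite D" "depends_on D f"
    using f local_fun_depends_on[OF f(1)] by (auto simp: D_def local_fun_def)
  have cont: "continuous_on UNIV f"
    using f by (simp add: local_fun_def)
  obtain B where B: "\<And>\<sigma>. \<bar>f \<sigma>\<bar> \<le> B"
    using f(2) unfolding bounded_iff by auto
  obtain r where r: "D \<subseteq> box_sites r"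
    using finite_subset_box_sites[OF D(1)] .
  \<comment> \<open>The constant of \<open>osc_norm_sq_shift_sum_le\<close>: squared oscillation
    norm per site of the box and per \<open>t\<^sup>2\<close>.\<close>
  define L where "L = real (card D) * (2 * B * real (card D))\<^sup>2"
  define K where "K = infsum (potential_norm U) {A. finite A \<and> 0 \<in> A}"
  define N where "N n = real (card (box_sites n :: 'd site set))" for n
  have Npos: "N n > 0" for n
    by (simp add: N_def card_box_sites)
  have key: "a \<le> (4 + C / 2 * L) * t" if t: "t > 0" for t
  proof -
    \<comment> \<open>The tolerance \<epsilon> is chosen as \<open>t\<^sup>2\<close>, so that the
      boundary error has the order of the concentration term and one factor \<open>t\<close>
      survives division by \<open>t\<close>.\<close>
    have "t\<^sup>2 > 0" using t by simp
    then obtain R\<^sub>0 where R\<^sub>0: "\<And>R n. R \<ge> R\<^sub>0 \<Longrightarrow> boundary_norm U (box_sites (n + R)) \<le> t\<^sup>2 * N n + K * (N (n + R) - N n)"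
      unfolding N_def K_def by (erule boundary_norm_box_sites_le)
    \<comment> \<open>\<open>R\<^sub>0\<close> serves the boundary estimate; \<open>r\<close>
      ensures that all translates of \<open>D\<close> by the inner box stay in the outer
      box.\<close>
    define R where "R = max R\<^sub>0 r"
    have bound: "t * a \<le> 4 * (t\<^sup>2 + K * (N (n + R) / N n - 1)) + C / 2 * (L * t\<^sup>2)" for n
    proof -
      let ?I = "box_sites n :: 'd site set" and ?W = "box_sites (n + R) :: 'd site set"
      let ?g = "\<lambda>\<sigma>. t * (\<Sum>i\<in>?I. f (shift (- i) \<sigma>))"
      have "(\<Union>i\<in>?I. (\<lambda>j. j + i) ` D) \<subseteq> ?W"
        using r box_sites_mono[of r R] add_box_sites[of _ n _ R]
        by (fastforce simp: R_def add.commute)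
      with depends_on_shift_sum[OF D(2)] have dep: "depends_on ?W ?g"
        by (rule depends_on_mono)
      have cont_shift: "continuous_on UNIV (\<lambda>\<sigma>. f (shift (- i) \<sigma>))" for i
        by (rule continuous_on_compose2[OF cont continuous_on_shift]) simp
      have loc: "local_fun ?g"
        by (rule depends_on_local_fun[OF _ dep card_box_sites(1)])
           (intro continuous_on_mult continuous_on_const continuous_on_sum cont_shift)
      have "\<bar>?g \<sigma>\<bar> \<le> t * (N n * B)" for \<sigma>
      proof -
        have "\<bar>\<Sum>i\<in>?I. f (shift (- i) \<sigma>)\<bar> \<le> (\<Sum>i\<in>?I. B)"
          by (rule order.trans[OF sum_abs sum_mono]) (rule B)
        then show ?thesis
          using t by (simp add: abs_mult N_def)
      qed
      then have bdd: "bounded (range ?g)"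
        unfolding bounded_iff by auto
      have mean: "(\<integral>\<sigma>. ?g \<sigma> \<partial>M) = t * (N n * (\<integral>\<sigma>. f \<sigma> \<partial>M))" if "M \<in> ti_gibbs_measures lam U" for M
      proof -
        have M: "is_prob_on_configs M" "translation_invariant M"
          using that by (auto simp: ti_gibbs_measures_def is_gibbs_def)
        have "integrable M (\<lambda>\<sigma>. f (shift (- i) \<sigma>))" for i
        proof (rule integrable_bounded_config[OF M(1)])
          show "bounded (range (\<lambda>\<sigma>. f (shift (- i) \<sigma>)))"
            using B unfolding bounded_iff by auto
        qed (rule borel_measurable_continuous_config[OF cont_shift])
        then have "(\<integral>\<sigma>. ?g \<sigma> \<partial>M) = t * (\<Sum>i\<in>?I. \<integral>\<sigma>. f (shift (- i) \<sigma>) \<partial>M)"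
          by simp
        then show ?thesis
          by (simp add: integral_shift[OF M borel_measurable_continuous_config[OF cont]] N_def)
      qed
      have "t * (N n * a) = (\<integral>\<sigma>. ?g \<sigma> \<partial>\<nu>) - (\<integral>\<sigma>. ?g \<sigma> \<partial>\<mu>)"
        by (simp only: mean[OF \<mu>] mean[OF \<nu>] a_def right_diff_distrib)
      also have "\<dots> \<le> 4 * boundary_norm U ?W + C / 2 * enn2real (osc_norm_sq ?g)"
        using \<mu> \<nu> by (intro gibbs_mean_difference_le[OF lam card_box_sites(1) _ _ gcb loc bdd dep])
          (auto simp: ti_gibbs_measures_def)
      also have "\<dots> \<le> 4 * (t\<^sup>2 * N n + K * (N (n + R) - N n)) + C / 2 * (N n * L * t\<^sup>2)"
        using osc_norm_sq_shift_sum_le[OF D(2,1) card_box_sites(1) B, of t n] t R\<^sub>0[of R n] C_pos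
        by (intro add_mono mult_left_mono) (auto simp: R_def L_def N_def)
      also have "\<dots> = N n * (4 * (t\<^sup>2 + K * (N (n + R) / N n - 1)) + C / 2 * (L * t\<^sup>2))"
        using Npos[of n] by (simp add: field_simps)
      finally have "N n * (t * a) \<le> N n * (4 * (t\<^sup>2 + K * (N (n + R) / N n - 1)) + C / 2 * (L * t\<^sup>2))"
        by (simp only: mult.left_commute)
      then show ?thesis
        using Npos[of n] by simp
    qed
    \<comment> \<open>Now \<open>n\<close> grows with \<open>t\<close> and \<open>R\<close> fixed,
      and the collar term with \<open>K\<close> disappears.\<close>
    have "(\<lambda>n. 4 * (t\<^sup>2 + K * (N (n + R) / N n - 1)) + C / 2 * (L * t\<^sup>2))
        \<longlonglongrightarrow> 4 * (t\<^sup>2 + K * (1 - 1)) + C / 2 * (L * t\<^sup>2)"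
      unfolding N_def by (intro tendsto_intros tendsto_card_box_sites_ratio)
    then have "t * a \<le> 4 * (t\<^sup>2 + K * (1 - 1)) + C / 2 * (L * t\<^sup>2)"
      by (rule tendsto_lowerbound[OF _ always_eventually[OF allI[OF bound]]]) simp
    then have "t * a \<le> t * ((4 + C / 2 * L) * t)"
      by (simp add: power2_eq_square algebra_simps)
    then show ?thesis
      using t by simp
  qed
  have "a \<le> 0"
  proof (rule ccontr)
    assume "\<not> a \<le> 0"
    then have a: "a > 0" by simp
    define X where "X = 4 + C / 2 * L"
    have X: "X > 0"
      using key[of 1] a by (simp add: X_def)
    \<comment> \<open>The choice \<open>t = a / (2 * X)\<close> makes the bound half of
      \<open>a\<close>, which contradicts positivity.\<close>
    have "a \<le> X * (a / (2 * X))"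
      unfolding X_def by (rule key) (use a X in \<open>simp add: X_def\<close>)
    also have "\<dots> = a / 2"
      using X by simp
    finally show False using a by simp
  qed
  then show ?thesis
    by (simp add: a_def)
qed

text \<open>The two measures cannot be exchanged, as \<open>GCB\<close> is assumed only for \<mu>;
  the reverse inequality comes from \<open>- f\<close> instead.\<close>

lemma gibbs_local_mean_eq:
  fixes f :: "('a, 'd) config \<Rightarrow> real"
  assumes lam: "prob_space lam" "sets lam = sets borel"
    and \<mu>: "\<mu> \<in> ti_gibbs_measures lam U" and \<nu>: "\<nu> \<in> ti_gibbs_measures lam U"
    and gcb: "C > 0" "GCB \<mu> C" and f: "local_fun f" "bounded (range f)"
  shows "(\<integral>\<sigma>. f \<sigma> \<partial>\<nu>) = (\<integral>\<sigma>. f \<sigma> \<partial>\<mu>)"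
proof (rule antisym)
  show "(\<integral>\<sigma>. f \<sigma> \<partial>\<nu>) \<le> (\<integral>\<sigma>. f \<sigma> \<partial>\<mu>)"
    by (rule gibbs_local_mean_le[OF lam \<mu> \<nu> gcb f])
  have "local_fun (\<lambda>\<sigma>. - f \<sigma>)"
  proof (rule depends_on_local_fun)
    show "continuous_on UNIV (\<lambda>\<sigma>. - f \<sigma>)" "finite {i. oscillation i f \<noteq> 0}"
      using f(1) by (auto simp: local_fun_def intro: continuous_on_minus)
    show "depends_on {i. oscillation i f \<noteq> 0} (\<lambda>\<sigma>. - f \<sigma>)"
      using local_fun_depends_on[OF f(1)] by (auto simp: depends_on_def)
  qed
  moreover have "bounded (range (\<lambda>\<sigma>. - f \<sigma>))"
    using f(2) by (simp add: bounded_iff)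
  ultimately have "(\<integral>\<sigma>. - f \<sigma> \<partial>\<nu>) \<le> (\<integral>\<sigma>. - f \<sigma> \<partial>\<mu>)"
    by (rule gibbs_local_mean_le[OF lam \<mu> \<nu> gcb])
  then show "(\<integral>\<sigma>. f \<sigma> \<partial>\<mu>) \<le> (\<integral>\<sigma>. f \<sigma> \<partial>\<nu>)"
    by simp
qed

end

section \<open>From local to quasi-local functions\<close>

lemma integral_uniform_distance_le:
  fixes M :: "('a::second_countable_topology, 'd::finite) config measure"
    and f g :: "('a, 'd) config \<Rightarrow> real"
  assumes M: "is_prob_on_configs M" and cont: "continuous_on UNIV f" "continuous_on UNIV g"
    and bdd: "bounded (range f)" "bounded (range g)" and le: "\<And>\<sigma>. \<bar>f \<sigma> - g \<sigma>\<bar> \<le> e"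
  shows "\<bar>(\<integral>\<sigma>. f \<sigma> \<partial>M) - (\<integral>\<sigma>. g \<sigma> \<partial>M)\<bar> \<le> e"
proof -
  interpret prob_space M by (rule is_prob_on_configsD[OF M])
  have int: "integrable M f" "integrable M g"
    by (intro integrable_bounded_config M borel_measurable_continuous_config cont bdd)+
  have "\<bar>(\<integral>\<sigma>. f \<sigma> \<partial>M) - (\<integral>\<sigma>. g \<sigma> \<partial>M)\<bar> = \<bar>\<integral>\<sigma>. f \<sigma> - g \<sigma> \<partial>M\<bar>"
    using int by simp
  also have "\<dots> \<le> (\<integral>\<sigma>. \<bar>f \<sigma> - g \<sigma>\<bar> \<partial>M)"
    by (rule integral_abs_bound)
  also have "\<dots> \<le> (\<integral>\<sigma>. e \<partial>M)"
    using int le by (intro integral_mono) auto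
  finally show ?thesis
    using prob_space by simp
qed

lemma quasilocal_mean_eq:
  fixes M N :: "('a::second_countable_topology, 'd::finite) config measure"
  assumes MN: "is_prob_on_configs M" "is_prob_on_configs N"
    and eq: "\<And>f :: ('a, 'd) config \<Rightarrow> real. local_fun f \<Longrightarrow> bounded (range f) \<Longrightarrow> (\<integral>\<sigma>. f \<sigma> \<partial>M) = (\<integral>\<sigma>. f \<sigma> \<partial>N)"
    and f: "quasilocal_fun f" "bounded (range f)"
  shows "(\<integral>\<sigma>. f \<sigma> \<partial>M) = (\<integral>\<sigma>. f \<sigma> \<partial>N)"
proof -
  obtain F where F: "\<And>n. local_fun (F n)" "uniform_limit UNIV F f sequentially"
    using f(1) by (auto simp: quasilocal_fun_def)
  have cont: "continuous_on UNIV f"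
    using f(1) by (simp add: quasilocal_fun_def)
  obtain B where B: "\<And>\<sigma>. \<bar>f \<sigma>\<bar> \<le> B"
    using f(2) unfolding bounded_iff by auto
  have le: "\<bar>(\<integral>\<sigma>. f \<sigma> \<partial>M) - (\<integral>\<sigma>. f \<sigma> \<partial>N)\<bar> \<le> 0 + e" if e: "e > 0" for e
  proof -
    have "\<forall>\<^sub>F n in sequentially. \<forall>\<sigma>\<in>UNIV. dist (F n \<sigma>) (f \<sigma>) < e / 2"
      by (rule uniform_limitD[OF F(2)]) (use e in simp)
    then obtain n where "\<forall>\<sigma>\<in>UNIV. dist (F n \<sigma>) (f \<sigma>) < e / 2"
      by (auto simp: eventually_sequentially)
    then have n: "\<bar>F n \<sigma> - f \<sigma>\<bar> \<le> e / 2" for \<sigma>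
      by (auto simp: dist_real_def less_imp_le)
    have cont_n: "continuous_on UNIV (F n)"
      using F(1) by (simp add: local_fun_def)
    \<comment> \<open>The approximants are not assumed bounded; closeness to the bounded
      \<open>f\<close> makes them so, and then their two means agree.\<close>
    have "\<bar>F n \<sigma>\<bar> \<le> B + e / 2" for \<sigma>
      using n[of \<sigma>] B[of \<sigma>] by linarith
    then have bdd: "bounded (range (F n))"
      unfolding bounded_iff by auto
    show ?thesis
      using integral_uniform_distance_le[OF MN(1) cont_n cont bdd f(2) n]
        integral_uniform_distance_le[OF MN(2) cont_n cont bdd f(2) n] eq[OF F(1) bdd]
      by linarith
  qed
  have "\<bar>(\<integral>\<sigma>. f \<sigma> \<partial>M) - (\<integral>\<sigma>. f \<sigma> \<partial>N)\<bar> \<le> 0"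
    using le by (rule field_le_epsilon)
  then show ?thesis by simp
qed

theorem proposition4p1:
  fixes lam :: "'a::polish_space measure"
    and U :: "('a, 'd::finite) potential"
    and \<mu> :: "('a, 'd) config measure"
    and C :: real
  assumes finite_diameter: "bounded (UNIV :: 'a set)"
    and separating: "measure_separating
          {f :: ('a, 'd) config \<Rightarrow> real. quasilocal_fun f \<and> bounded (range f)}"
    and a_priori: "prob_space lam" "sets lam = sets borel"
    and potential: "uas_ti_potential U"
    and gibbs: "\<mu> \<in> ti_gibbs_measures lam U"
    and C_pos: "C > 0"
    and gcb: "GCB \<mu> C"
  shows "ti_gibbs_measures lam U = {\<mu>}"
proof (rule antisym)
  interpret uas_potential U
    by unfold_locales (rule potential)
  show "ti_gibbs_measures lam U \<subseteq> {\<mu>}"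
  proof (rule subsetI, rule ccontr)
    fix \<nu> assume \<nu>: "\<nu> \<in> ti_gibbs_measures lam U" and "\<nu> \<notin> {\<mu>}"
    then have "\<nu> \<noteq> \<mu>" by simp
    have prob: "is_prob_on_configs \<nu>" "is_prob_on_configs \<mu>"
      using \<nu> gibbs by (auto simp: ti_gibbs_measures_def is_gibbs_def)
    \<comment> \<open>A second measure would be told apart from \<mu> by a bounded quasi-local
      function, yet uniform approximation forces equal means on these.\<close>
    then obtain f :: "('a, 'd) config \<Rightarrow> real" where f: "quasilocal_fun f" "bounded (range f)"
      and neq: "(\<integral>\<sigma>. f \<sigma> \<partial>\<nu>) \<noteq> (\<integral>\<sigma>. f \<sigma> \<partial>\<mu>)"
      using separating \<open>\<nu> \<noteq> \<mu>\<close> unfolding measure_separating_def by blast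
    have "(\<integral>\<sigma>. f \<sigma> \<partial>\<nu>) = (\<integral>\<sigma>. f \<sigma> \<partial>\<mu>)"
      by (rule quasilocal_mean_eq[OF prob gibbs_local_mean_eq[OF a_priori gibbs \<nu> C_pos gcb] f])
    with neq show False by contradiction
  qed
qed (use gibbs in simp)

end
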